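(* The homomorphism $\delta:\widetilde{GL}_q(2)\to\widetilde{GL}_q(2)^{\otimes2}$ defined on generators by $$\delta(a)=a\otimes\theta+b\otimes a,\quad \delta(\theta)=\theta\otimes\theta,\quad \delta(c)=c\otimes c,\quad \delta(b)=b\otimes b,\quad \delta(d)=c\otimes d$$ is a coassociative algebra homomorphism, i.e. it is compatible with the defining relations of $\widetilde{GL}_q(2)$ and satisfies $(\mathrm{id}\otimes\delta)\delta(x)=(\delta\otimes\mathrm{id})\delta(x)$ for all $x$; and it is a $*$-homomorphism with respect to the anti-involution $*$ given by $a^*=a$, $b^*=b$, $c^*=c$, $d^*=d$, $\theta^*=\theta$, i.e. $( *\otimes* )\,\delta(x)=\delta(x^* )$.
   Context: Let $\gamma\in(0,\pi)$, $q=e^{i\gamma}$. $\widetilde{GL}_q(2)$ is the unital associative algebra over $\mathbb C$ with generators $a,b,c,d,\theta$ and relations $[a,d]=(q-q^{-1})bc$, $[b,c]=0$, $ab=q\,ba$, $ac=q\,ca$, $bd=q\,db$, $cd=q\,dc$, $a\theta=q^{-1}\theta a$, $\theta d=q^{-1}d\theta$, $[b,\theta]=0$, $[\theta,c]=0$. The anti-involution $*$ is antilinear and antimultiplicative. *)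

theory Defs
  imports Complex_Main "HOL-Algebra.Module" "HOL-Algebra.QuotRing" "HOL-Algebra.Free_Abelian_Groups"
begin

text \<open>
  A unital associative complex algebra is represented by a record of type
  \<open>(complex, 'a) module\<close>, using all of its ring and scalar multiplication fields. (The library
  locale \<^locale>\<open>algebra\<close> is not used because it requires a commutative multiplication.)
\<close>

definition algebra_hom ::
  "(complex, 'a) module \<Rightarrow> (complex, 'b) module \<Rightarrow> ('a \<Rightarrow> 'b) set" where
  "algebra_hom A B =
     {f \<in> ring_hom A B. \<forall>r. \<forall>x\<in>carrier A. f (r \<odot>\<^bsub>A\<^esub> x) = r \<odot>\<^bsub>B\<^esub> f x}"

definition anti_involution :: "(complex, 'a) module \<Rightarrow> ('a \<Rightarrow> 'a) \<Rightarrow> bool" where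
  "anti_involution A s \<longleftrightarrow>
     s \<in> carrier A \<rightarrow> carrier A \<and>
     (\<forall>x\<in>carrier A. \<forall>y\<in>carrier A. s (x \<oplus>\<^bsub>A\<^esub> y) = s x \<oplus>\<^bsub>A\<^esub> s y) \<and>
     (\<forall>r. \<forall>x\<in>carrier A. s (r \<odot>\<^bsub>A\<^esub> x) = cnj r \<odot>\<^bsub>A\<^esub> s x) \<and>
     (\<forall>x\<in>carrier A. \<forall>y\<in>carrier A. s (x \<otimes>\<^bsub>A\<^esub> y) = s y \<otimes>\<^bsub>A\<^esub> s x) \<and>
     (\<forall>x\<in>carrier A. s (s x) = x)"

datatype 'g word = Word (letters: "'g list")

text \<open>
  With concatenation as addition of words, the convolution product that the library defines on
  finitely supported functions is the product of the free algebra.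
\<close>

instantiation word :: (type) monoid_add
begin

definition zero_word :: "'g word" where "zero_word = Word []"

definition plus_word :: "'g word \<Rightarrow> 'g word \<Rightarrow> 'g word" where
  "plus_word v w = Word (letters v @ letters w)"

instance
  by standard (simp_all add: zero_word_def plus_word_def)

end

type_synonym 'g ncpoly = "'g word \<Rightarrow>\<^sub>0 complex"

definition scale :: "complex \<Rightarrow> 'g ncpoly \<Rightarrow> 'g ncpoly" where
  "scale r = Poly_Mapping.map ((*) r)"

definition var :: "'g \<Rightarrow> 'g ncpoly" where
  "var g = Poly_Mapping.single (Word [g]) 1"

definition free_algebra :: "(complex, 'g ncpoly) module" where
  "free_algebra =
     \<lparr>carrier = UNIV, monoid.mult = (*), one = 1, ring.zero = 0, add = (+), smult = scale\<rparr>"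

definition presented_algebra :: "'g ncpoly set \<Rightarrow> (complex, 'g ncpoly set) module" where
  "presented_algebra R =
     (let I = Idl\<^bsub>free_algebra\<^esub> R in
      ring.extend (free_algebra Quot I)
        (module.fields (\<lambda>r X. \<Union>x\<in>X. I +>\<^bsub>free_algebra\<^esub> (r \<odot>\<^bsub>free_algebra\<^esub> x))))"

definition presented_gen :: "'g ncpoly set \<Rightarrow> 'g \<Rightarrow> 'g ncpoly set" where
  "presented_gen R g = (Idl\<^bsub>free_algebra\<^esub> R) +>\<^bsub>free_algebra\<^esub> var g"

text \<open>
  The tensor product over the complex numbers is the quotient of the free abelian group on pairs
  by the biadditivity relations and the relations \<open>(r x, y) = (x, r y)\<close>. Building it over the
  integers allows one notion of \<open>f \<otimes> g\<close> for linear and for antilinear maps.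
\<close>

definition tensor_rels :: "(complex, 'a) module \<Rightarrow> (complex, 'b) module \<Rightarrow> ('a \<times> 'b \<Rightarrow>\<^sub>0 int) set" where
  "tensor_rels A B =
     {frag_of (x \<oplus>\<^bsub>A\<^esub> x', y) - frag_of (x, y) - frag_of (x', y) |x x' y.
        x \<in> carrier A \<and> x' \<in> carrier A \<and> y \<in> carrier B} \<union>
     {frag_of (x, y \<oplus>\<^bsub>B\<^esub> y') - frag_of (x, y) - frag_of (x, y') |x y y'.
        x \<in> carrier A \<and> y \<in> carrier B \<and> y' \<in> carrier B} \<union>
     {frag_of (r \<odot>\<^bsub>A\<^esub> x, y) - frag_of (x, r \<odot>\<^bsub>B\<^esub> y) |r x y.
        x \<in> carrier A \<and> y \<in> carrier B}"

abbreviation pair_group ::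
  "(complex, 'a) module \<Rightarrow> (complex, 'b) module \<Rightarrow> ('a \<times> 'b \<Rightarrow>\<^sub>0 int) monoid" where
  "pair_group A B \<equiv> free_Abelian_group (carrier A \<times> carrier B)"

definition tensor_null :: "(complex, 'a) module \<Rightarrow> (complex, 'b) module \<Rightarrow> ('a \<times> 'b \<Rightarrow>\<^sub>0 int) set" where
  "tensor_null A B = generate (pair_group A B) (tensor_rels A B)"

definition tensor_class ::
  "(complex, 'a) module \<Rightarrow> (complex, 'b) module \<Rightarrow> ('a \<times> 'b \<Rightarrow>\<^sub>0 int) \<Rightarrow> ('a \<times> 'b \<Rightarrow>\<^sub>0 int) set" where
  "tensor_class A B u = tensor_null A B #>\<^bsub>pair_group A B\<^esub> u"

definition pure_tensor ::
  "(complex, 'a) module \<Rightarrow> (complex, 'b) module \<Rightarrow> 'a \<Rightarrow> 'b \<Rightarrow> ('a \<times> 'b \<Rightarrow>\<^sub>0 int) set" where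
  "pure_tensor A B x y = tensor_class A B (frag_of (x, y))"

definition pair_mult ::
  "(complex, 'a) module \<Rightarrow> (complex, 'b) module \<Rightarrow>
     ('a \<times> 'b \<Rightarrow>\<^sub>0 int) \<Rightarrow> ('a \<times> 'b \<Rightarrow>\<^sub>0 int) \<Rightarrow> ('a \<times> 'b \<Rightarrow>\<^sub>0 int)" where
  "pair_mult A B u v =
     frag_extend (\<lambda>(x, y). frag_extend (\<lambda>(x', y'). frag_of (x \<otimes>\<^bsub>A\<^esub> x', y \<otimes>\<^bsub>B\<^esub> y')) v) u"

definition pair_scale ::
  "(complex, 'a) module \<Rightarrow> complex \<Rightarrow> ('a \<times> 'b \<Rightarrow>\<^sub>0 int) \<Rightarrow> ('a \<times> 'b \<Rightarrow>\<^sub>0 int)" where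
  "pair_scale A r = frag_extend (\<lambda>(x, y). frag_of (r \<odot>\<^bsub>A\<^esub> x, y))"

definition tensor_algebra ::
  "(complex, 'a) module \<Rightarrow> (complex, 'b) module \<Rightarrow> (complex, ('a \<times> 'b \<Rightarrow>\<^sub>0 int) set) module" where
  "tensor_algebra A B =
     \<lparr>carrier = carrier (pair_group A B Mod tensor_null A B),
      monoid.mult = (\<lambda>X Y. \<Union>u\<in>X. \<Union>v\<in>Y. tensor_class A B (pair_mult A B u v)),
      one = pure_tensor A B \<one>\<^bsub>A\<^esub> \<one>\<^bsub>B\<^esub>,
      ring.zero = tensor_null A B,
      add = monoid.mult (pair_group A B Mod tensor_null A B),
      smult = (\<lambda>r X. \<Union>u\<in>X. tensor_class A B (pair_scale A r u))\<rparr>"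

text \<open>
  The additive map out of a tensor product that sends \<open>x \<otimes> y\<close> to \<open>\<phi> x y\<close>. It is meaningful
  when \<open>\<phi>\<close> is biadditive and balanced, so that the sum below takes a single value on each coset.
\<close>

definition tensor_lift ::
  "(complex, 'c) module \<Rightarrow> ('a \<Rightarrow> 'b \<Rightarrow> 'c) \<Rightarrow> ('a \<times> 'b \<Rightarrow>\<^sub>0 int) set \<Rightarrow> 'c" where
  "tensor_lift M \<phi> X =
     the_elem ((\<lambda>u. \<Oplus>\<^bsub>M\<^esub>k\<in>Poly_Mapping.keys u.
                      [Poly_Mapping.lookup u k] \<cdot>\<^bsub>M\<^esub> \<phi> (fst k) (snd k)) ` X)"

definition tensor_map ::
  "(complex, 'c) module \<Rightarrow> (complex, 'd) module \<Rightarrow> ('a \<Rightarrow> 'c) \<Rightarrow> ('b \<Rightarrow> 'd) \<Rightarrow>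
     ('a \<times> 'b \<Rightarrow>\<^sub>0 int) set \<Rightarrow> ('c \<times> 'd \<Rightarrow>\<^sub>0 int) set" where
  "tensor_map A' B' f g =
     tensor_lift (tensor_algebra A' B') (\<lambda>x y. pure_tensor A' B' (f x) (g y))"

text \<open>The canonical map from \<open>(A \<otimes> B) \<otimes> C\<close> to \<open>A \<otimes> (B \<otimes> C)\<close>.\<close>

definition tensor_assoc ::
  "(complex, 'a) module \<Rightarrow> (complex, 'b) module \<Rightarrow> (complex, 'c) module \<Rightarrow>
     (('a \<times> 'b \<Rightarrow>\<^sub>0 int) set \<times> 'c \<Rightarrow>\<^sub>0 int) set \<Rightarrow> ('a \<times> ('b \<times> 'c \<Rightarrow>\<^sub>0 int) set \<Rightarrow>\<^sub>0 int) set" where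
  "tensor_assoc A B C =
     (let T = tensor_algebra A (tensor_algebra B C) in
      tensor_lift T (\<lambda>X z. tensor_lift T
        (\<lambda>x y. pure_tensor A (tensor_algebra B C) x (pure_tensor B C y z)) X))"

datatype gl_gen = Ga | Gb | Gc | Gd | Gtheta

definition gl_rels :: "complex \<Rightarrow> gl_gen ncpoly set" where
  "gl_rels q =
     (let a = var Ga; b = var Gb; c = var Gc; d = var Gd; \<theta> = var Gtheta in
      {(a * d - d * a) - scale (q - inverse q) (b * c),
       b * c - c * b,
       a * b - scale q (b * a),
       a * c - scale q (c * a),
       b * d - scale q (d * b),
       c * d - scale q (d * c),
       a * \<theta> - scale (inverse q) (\<theta> * a),
       \<theta> * d - scale (inverse q) (d * \<theta>),
       b * \<theta> - \<theta> * b,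
       \<theta> * c - c * \<theta>})"

definition GL :: "complex \<Rightarrow> (complex, gl_gen ncpoly set) module" where
  "GL q = presented_algebra (gl_rels q)"

definition GL2 :: "complex \<Rightarrow> (complex, (gl_gen ncpoly set \<times> gl_gen ncpoly set \<Rightarrow>\<^sub>0 int) set) module" where
  "GL2 q = tensor_algebra (GL q) (GL q)"

text \<open>
  Maps on an algebra are normalised to be \<open>undefined\<close> outside the carrier, so that uniqueness
  is uniqueness as maps on the carrier.
\<close>

definition gl_coproduct ::
  "complex \<Rightarrow> (gl_gen ncpoly set \<Rightarrow> (gl_gen ncpoly set \<times> gl_gen ncpoly set \<Rightarrow>\<^sub>0 int) set) \<Rightarrow> bool" where
  "gl_coproduct q \<delta> \<longleftrightarrow>
     (let a = presented_gen (gl_rels q) Ga; b = presented_gen (gl_rels q) Gb;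
          c = presented_gen (gl_rels q) Gc; d = presented_gen (gl_rels q) Gd;
          \<theta> = presented_gen (gl_rels q) Gtheta; t = pure_tensor (GL q) (GL q) in
      \<delta> \<in> algebra_hom (GL q) (GL2 q) \<and> \<delta> \<in> extensional (carrier (GL q)) \<and>
      \<delta> a = t a \<theta> \<oplus>\<^bsub>GL2 q\<^esub> t b a \<and>
      \<delta> \<theta> = t \<theta> \<theta> \<and>
      \<delta> c = t c c \<and>
      \<delta> b = t b b \<and>
      \<delta> d = t c d)"

definition gl_star :: "complex \<Rightarrow> (gl_gen ncpoly set \<Rightarrow> gl_gen ncpoly set) \<Rightarrow> bool" where
  "gl_star q s \<longleftrightarrow>
     anti_involution (GL q) s \<and> s \<in> extensional (carrier (GL q)) \<and>
     (\<forall>g. s (presented_gen (gl_rels q) g) = presented_gen (gl_rels q) g)"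

end

theory Submission
  imports Defs
begin

text \<open>
  The algebra is presented by generators and relations, so it has a universal property: a unital
  algebra homomorphism out of it exists as soon as the images of the generators satisfy the ten
  relations, and it is determined by these images (\<open>GL_hom_exists\<close>, \<open>GL_hom_eqI\<close>). Existence and
  uniqueness of \<open>\<delta>\<close> is this property for the target \<open>GL \<otimes> GL\<close>. The
  relation that needs a thought is the one for \<open>[a, d]\<close>: in
  \<open>\<delta> a * \<delta> d = a c \<otimes> \<theta> d + b c \<otimes> a d\<close> the first summand equals \<open>c a \<otimes> d \<theta>\<close>, because the factor \<open>q\<close>
  from \<open>a c = q c a\<close> cancels the factor \<open>inverse q\<close> from \<open>\<theta> d = inverse q d \<theta>\<close>; the second one
  contributes \<open>(q - inverse q) b c \<otimes> b c\<close> to the commutator.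

  The two identities then follow by comparing homomorphisms on generators. Coassociativity compares
  \<open>(id \<otimes> \<delta>) \<delta>\<close> with \<open>(\<delta> \<otimes> id) \<delta>\<close> followed by the canonical associativity map. This requires that tensor
  products of algebras are algebras, that \<open>f \<otimes> g\<close> is a homomorphism and that the associativity map
  is one (\<open>tensor_map_hom\<close>, \<open>tensor_assoc_hom\<close>).

  An anti-involution is antilinear and reverses products, so the universal property does not apply
  to it directly. It is turned into an ordinary homomorphism by changing the target: an antilinear
  antimultiplicative map \<open>A \<rightarrow> B\<close> is an algebra homomorphism from \<open>A\<close> to the conjugate opposite algebra
  \<open>conj_op B\<close>. Forming the conjugate opposite commutes with the tensor product, hence
  \<open>* \<otimes> *\<close> is again covered by the functoriality of the tensor product, and \<open>(* \<otimes> *) \<delta> = \<delta> *\<close> is one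
  more comparison on generators, this time of homomorphisms \<open>GL \<rightarrow> conj_op (GL \<otimes> GL)\<close>. The assumption
  on \<open>q\<close> enters through \<open>cnj q = inverse q\<close>: reversing \<open>a b = q b a\<close> and conjugating the coefficient
  gives \<open>b a = inverse q a b\<close>, which is the same relation, and \<open>q - inverse q\<close> changes its sign together
  with the commutator \<open>[a, d]\<close>.
\<close>

section \<open>Complex algebras, homomorphisms and quotients\<close>

locale cx_algebra = ring A for A :: "(complex, 'a) module" (structure) +
  assumes smult_closed [simp, intro]: "x \<in> carrier A \<Longrightarrow> r \<odot> x \<in> carrier A"
    and smult_add_right: "\<lbrakk>x \<in> carrier A; y \<in> carrier A\<rbrakk> \<Longrightarrow> r \<odot> (x \<oplus> y) = r \<odot> x \<oplus> r \<odot> y"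
    and smult_add_left: "x \<in> carrier A \<Longrightarrow> (r + s) \<odot> x = r \<odot> x \<oplus> s \<odot> x"
    and smult_smult: "x \<in> carrier A \<Longrightarrow> r \<odot> (s \<odot> x) = (r * s) \<odot> x"
    and smult_one [simp]: "x \<in> carrier A \<Longrightarrow> 1 \<odot> x = x"
    and smult_mult_left: "\<lbrakk>x \<in> carrier A; y \<in> carrier A\<rbrakk> \<Longrightarrow> (r \<odot> x) \<otimes> y = r \<odot> (x \<otimes> y)"
    and smult_mult_right: "\<lbrakk>x \<in> carrier A; y \<in> carrier A\<rbrakk> \<Longrightarrow> x \<otimes> (r \<odot> y) = r \<odot> (x \<otimes> y)"
begin

lemma smult_zero_left [simp]: "x \<in> carrier A \<Longrightarrow> 0 \<odot> x = \<zero>"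
  using smult_add_left[of x 0 0] by simp

lemma smult_minus_one: "x \<in> carrier A \<Longrightarrow> (- 1) \<odot> x = \<ominus> x"
  using smult_add_left[of x "- 1" 1] by (intro minus_equality[symmetric]) simp_all

end

lemma algebra_homI:
  assumes "\<And>x. x \<in> carrier A \<Longrightarrow> f x \<in> carrier B"
    and "\<And>x y. \<lbrakk>x \<in> carrier A; y \<in> carrier A\<rbrakk> \<Longrightarrow> f (x \<oplus>\<^bsub>A\<^esub> y) = f x \<oplus>\<^bsub>B\<^esub> f y"
    and "\<And>x y. \<lbrakk>x \<in> carrier A; y \<in> carrier A\<rbrakk> \<Longrightarrow> f (x \<otimes>\<^bsub>A\<^esub> y) = f x \<otimes>\<^bsub>B\<^esub> f y"
    and "f \<one>\<^bsub>A\<^esub> = \<one>\<^bsub>B\<^esub>"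
    and "\<And>r x. x \<in> carrier A \<Longrightarrow> f (r \<odot>\<^bsub>A\<^esub> x) = r \<odot>\<^bsub>B\<^esub> f x"
  shows "f \<in> algebra_hom A B"
  using assms unfolding algebra_hom_def by (auto intro!: ring_hom_memI)

lemma algebra_homD:
  assumes "f \<in> algebra_hom A B"
  shows "x \<in> carrier A \<Longrightarrow> f x \<in> carrier B"
    and "\<lbrakk>x \<in> carrier A; y \<in> carrier A\<rbrakk> \<Longrightarrow> f (x \<oplus>\<^bsub>A\<^esub> y) = f x \<oplus>\<^bsub>B\<^esub> f y"
    and "\<lbrakk>x \<in> carrier A; y \<in> carrier A\<rbrakk> \<Longrightarrow> f (x \<otimes>\<^bsub>A\<^esub> y) = f x \<otimes>\<^bsub>B\<^esub> f y"
    and "f \<one>\<^bsub>A\<^esub> = \<one>\<^bsub>B\<^esub>"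
    and "x \<in> carrier A \<Longrightarrow> f (r \<odot>\<^bsub>A\<^esub> x) = r \<odot>\<^bsub>B\<^esub> f x"
  using assms unfolding algebra_hom_def by (auto dest: ring_hom_memE)

lemma algebra_hom_compose:
  assumes "f \<in> algebra_hom A B" "g \<in> algebra_hom B C"
  shows "(\<lambda>x. g (f x)) \<in> algebra_hom A C"
  by (rule algebra_homI) (simp_all add: algebra_homD[OF assms(1)] algebra_homD[OF assms(2)])

lemma algebra_hom_ident: "(\<lambda>x. x) \<in> algebra_hom A A"
  by (rule algebra_homI) simp_all

lemma algebra_hom_restrict:
  assumes A: "ring A" and f: "f \<in> algebra_hom A B" and f': "\<And>r x. x \<in> carrier A \<Longrightarrow> r \<odot>\<^bsub>A\<^esub> x \<in> carrier A"
  shows "restrict f (carrier A) \<in> algebra_hom A B"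
proof -
  interpret ring A by (rule A)
  show ?thesis
    by (rule algebra_homI) (simp_all add: algebra_homD[OF f] f')
qed

text \<open>
  Presented algebras and tensor products are both quotients of a ring by an ideal on which the
  scalars act through representatives. The operation \<open>\<sigma> r\<close> is multiplication by \<open>r\<close> on
  representatives.
\<close>

definition quotient_algebra ::
  "('a, 'm) ring_scheme \<Rightarrow> 'a set \<Rightarrow> (complex \<Rightarrow> 'a \<Rightarrow> 'a) \<Rightarrow> (complex, 'a set) module" where
  "quotient_algebra R I \<sigma> =
     ring.extend (R Quot I) (module.fields (\<lambda>r X. \<Union>x\<in>X. I +>\<^bsub>R\<^esub> \<sigma> r x))"

text \<open>
  Additivity in the scalar is demanded only modulo the ideal. This is the one law that fails on
  representatives of a tensor product: \<open>((r + s) x, y)\<close> and \<open>(r x, y) + (s x, y)\<close> are different formal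
  sums of pairs.
\<close>

locale scalar_ideal = ideal I R for I and R (structure) +
  fixes \<sigma> :: "complex \<Rightarrow> 'a \<Rightarrow> 'a"
  assumes scalar_closed [simp]: "x \<in> carrier R \<Longrightarrow> \<sigma> r x \<in> carrier R"
    and scalar_ideal: "x \<in> I \<Longrightarrow> \<sigma> r x \<in> I"
    and scalar_add_right: "\<lbrakk>x \<in> carrier R; y \<in> carrier R\<rbrakk> \<Longrightarrow> \<sigma> r (x \<oplus> y) = \<sigma> r x \<oplus> \<sigma> r y"
    and scalar_add_left: "x \<in> carrier R \<Longrightarrow> I +> \<sigma> (r + s) x = I +> (\<sigma> r x \<oplus> \<sigma> s x)"
    and scalar_scalar: "x \<in> carrier R \<Longrightarrow> \<sigma> r (\<sigma> s x) = \<sigma> (r * s) x"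
    and scalar_one: "x \<in> carrier R \<Longrightarrow> \<sigma> 1 x = x"
    and scalar_mult_left: "\<lbrakk>x \<in> carrier R; y \<in> carrier R\<rbrakk> \<Longrightarrow> \<sigma> r x \<otimes> y = \<sigma> r (x \<otimes> y)"
    and scalar_mult_right: "\<lbrakk>x \<in> carrier R; y \<in> carrier R\<rbrakk> \<Longrightarrow> x \<otimes> \<sigma> r y = \<sigma> r (x \<otimes> y)"
begin

abbreviation Q where "Q \<equiv> quotient_algebra R I \<sigma>"

lemma carrier_quotient: "carrier Q = (\<lambda>x. I +> x) ` carrier R"
  by (auto simp: quotient_algebra_def ring.defs FactRing_simps)

lemma coset_closed [simp]: "x \<in> carrier R \<Longrightarrow> I +> x \<in> carrier Q"
  by (simp add: carrier_quotient)

lemma quotient_zero: "\<zero>\<^bsub>Q\<^esub> = I +> \<zero>"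
  by (simp add: quotient_algebra_def ring.defs FactRing_simps a_subset)

lemma quotient_one: "\<one>\<^bsub>Q\<^esub> = I +> \<one>"
  by (simp add: quotient_algebra_def ring.defs FactRing_simps)

lemma quotient_add:
  "\<lbrakk>x \<in> carrier R; y \<in> carrier R\<rbrakk> \<Longrightarrow> (I +> x) \<oplus>\<^bsub>Q\<^esub> (I +> y) = I +> (x \<oplus> y)"
  by (simp add: quotient_algebra_def ring.defs FactRing_simps a_rcos_sum)

lemma quotient_mult:
  "\<lbrakk>x \<in> carrier R; y \<in> carrier R\<rbrakk> \<Longrightarrow> (I +> x) \<otimes>\<^bsub>Q\<^esub> (I +> y) = I +> (x \<otimes> y)"
  by (simp add: quotient_algebra_def ring.defs FactRing_simps rcoset_mult_add)

lemma coset_eqI: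
  assumes "y \<in> carrier R" "i \<in> I"
  shows "I +> (i \<oplus> y) = I +> y"
  using assms by (metis a_coset_add_assoc a_rcos_const a_subset Icarr)

lemma coset_eqD:
  assumes "x \<in> I +> y"
  obtains i where "i \<in> I" "x = i \<oplus> y"
  using assms by (auto simp: a_r_coset_def r_coset_def)

lemma quotient_smult:
  assumes "x \<in> carrier R"
  shows "r \<odot>\<^bsub>Q\<^esub> (I +> x) = I +> \<sigma> r x"
proof -
  have "I +> \<sigma> r y = I +> \<sigma> r x" if "y \<in> I +> x" for y
    using that assms
    by (elim coset_eqD) (simp add: scalar_add_right Icarr coset_eqI scalar_ideal)
  then have "(\<Union>y\<in>I +> x. I +> \<sigma> r y) = (\<Union>y\<in>I +> x. I +> \<sigma> r x)"
    by (rule SUP_cong[OF refl])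
  also have "\<dots> = I +> \<sigma> r x"
    using a_rcos_self[OF assms] by blast
  finally show ?thesis
    by (simp add: quotient_algebra_def ring.defs module.defs)
qed

lemma quotient_cx_algebra: "cx_algebra Q"
proof -
  have ringQ: "ring Q"
  proof (rule ringI)
    interpret FR: ring "R Quot I" by (rule quotient_is_ring)
    show "abelian_group Q"
    proof (rule abelian_groupI)
      fix X assume "X \<in> carrier Q"
      then show "\<exists>Y\<in>carrier Q. Y \<oplus>\<^bsub>Q\<^esub> X = \<zero>\<^bsub>Q\<^esub>"
        using FR.l_neg[of X] FR.a_inv_closed[of X] by (auto simp: quotient_algebra_def ring.defs)
    qed (simp_all add: quotient_algebra_def ring.defs FR.a_ac)
    show "Group.monoid Q"
      by (rule monoidI) (auto simp: quotient_algebra_def ring.defs FR.m_assoc)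
  qed (auto simp: carrier_quotient quotient_mult quotient_add l_distr r_distr)
  then interpret ring Q .
  show ?thesis
    by unfold_locales
      (auto simp: carrier_quotient quotient_mult quotient_add quotient_smult scalar_add_right
        scalar_add_left scalar_scalar scalar_one scalar_mult_left scalar_mult_right)
qed

lemma the_elem_image_coset:
  assumes "x \<in> carrier R" "\<And>i. i \<in> I \<Longrightarrow> f (i \<oplus> x) = f x"
  shows "the_elem (f ` (I +> x)) = f x"
proof -
  have "f y = f x" if "y \<in> I +> x" for y
    using that assms(2) by (auto elim: coset_eqD)
  then have "f ` (I +> x) = {f x}"
    using a_rcos_self[OF assms(1)] by blast
  then show ?thesis by simp
qed

end

section \<open>Free algebras and presented algebras\<close>

text \<open>
  Evaluation of a noncommutative polynomial and evaluation of a formal sum of pairs are both sums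
  over a support that changes with the argument. Extending the sums of both arguments to a common
  finite set, where the additional terms vanish, makes such an evaluation additive.
\<close>

lemma (in abelian_monoid) finsum_keys_add:
  fixes p q :: "'k \<Rightarrow>\<^sub>0 'v::comm_monoid_add"
  assumes closed: "\<And>k m. k \<in> S \<Longrightarrow> F k m \<in> carrier G"
    and add: "\<And>k m n. k \<in> S \<Longrightarrow> F k (m + n) = F k m \<oplus> F k n"
    and zero: "\<And>k. k \<in> S \<Longrightarrow> F k 0 = \<zero>"
    and keys: "Poly_Mapping.keys p \<subseteq> S" "Poly_Mapping.keys q \<subseteq> S"
  shows "(\<Oplus>k\<in>Poly_Mapping.keys (p + q). F k (Poly_Mapping.lookup (p + q) k)) =
    (\<Oplus>k\<in>Poly_Mapping.keys p. F k (Poly_Mapping.lookup p k)) \<oplus>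
    (\<Oplus>k\<in>Poly_Mapping.keys q. F k (Poly_Mapping.lookup q k))"
proof -
  define U where "U = Poly_Mapping.keys p \<union> Poly_Mapping.keys q"
  have U: "finite U" "U \<subseteq> S"
    using keys by (auto simp: U_def)
  have extend: "(\<Oplus>k\<in>Poly_Mapping.keys u. F k (Poly_Mapping.lookup u k)) =
      (\<Oplus>k\<in>U. F k (Poly_Mapping.lookup u k))" if "Poly_Mapping.keys u \<subseteq> U" for u
    using U that
    by (intro add.finprod_mono_neutral_cong_left)
      (auto simp: in_keys_iff subset_iff intro!: zero closed)
  have "(\<Oplus>k\<in>U. F k (Poly_Mapping.lookup (p + q) k)) =
      (\<Oplus>k\<in>U. F k (Poly_Mapping.lookup p k) \<oplus> F k (Poly_Mapping.lookup q k))"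
    using U by (intro finsum_cong') (auto simp: lookup_add add closed subset_iff)
  also have "\<dots> = (\<Oplus>k\<in>U. F k (Poly_Mapping.lookup p k)) \<oplus> (\<Oplus>k\<in>U. F k (Poly_Mapping.lookup q k))"
    using U by (intro finsum_addf) (auto simp: closed subset_iff)
  finally show ?thesis
    using extend[of p] extend[of q] extend[of "p + q"] keys_add[of p q] by (simp add: U_def)
qed

lemma free_algebra_simps [simp]:
  "carrier free_algebra = UNIV" "x \<otimes>\<^bsub>free_algebra\<^esub> y = x * y" "\<one>\<^bsub>free_algebra\<^esub> = 1"
  "\<zero>\<^bsub>free_algebra\<^esub> = 0" "x \<oplus>\<^bsub>free_algebra\<^esub> y = x + y" "r \<odot>\<^bsub>free_algebra\<^esub> x = scale r x"
  by (simp_all add: free_algebra_def)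

lemma scale_eq_mult: "scale r p = Poly_Mapping.single 0 r * p"
  by (simp add: scale_def mult_map_scale_conv_mult)

lemma ncpoly_induct [case_names single add]:
  assumes single: "\<And>w c. P (Poly_Mapping.single w c)"
    and add: "\<And>p q. \<lbrakk>P p; P q\<rbrakk> \<Longrightarrow> P (p + q)"
  shows "P (p :: 'g ncpoly)"
proof (induction p rule: update_induct)
  case const
  show ?case using single[of 0 0] by simp
next
  case (update f a b)
  have "Poly_Mapping.update a b f = f + Poly_Mapping.single a b"
    using update(1)
    by (intro poly_mapping_eqI) (auto simp: lookup_update lookup_add lookup_single in_keys_iff when_def)
  then show ?case using update add single by simp
qed

text \<open>Constant polynomials are central although words do not commute.\<close>

lemma mult_scalar_commute: "p * Poly_Mapping.single 0 r = Poly_Mapping.single 0 r * (p :: 'g ncpoly)"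
  by (induction p rule: ncpoly_induct) (simp_all add: mult_single distrib_left distrib_right mult.commute)

lemma free_cx_algebra: "cx_algebra (free_algebra :: (complex, 'g ncpoly) module)"
proof -
  have "ring (free_algebra :: (complex, 'g ncpoly) module)"
  proof (rule ringI)
    show "abelian_group (free_algebra :: (complex, 'g ncpoly) module)"
    proof (rule abelian_groupI)
      fix x :: "'g ncpoly"
      show "\<exists>y\<in>carrier free_algebra. y \<oplus>\<^bsub>free_algebra\<^esub> x = \<zero>\<^bsub>free_algebra\<^esub>"
        by (rule bexI[of _ "- x"]) simp_all
    qed (simp_all add: add_ac)
    show "Group.monoid (free_algebra :: (complex, 'g ncpoly) module)"
      by (rule monoidI) (simp_all add: mult.assoc)
  qed (simp_all add: distrib_left distrib_right)
  then interpret ring "free_algebra :: (complex, 'g ncpoly) module" .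
  have "x * (Poly_Mapping.single 0 r * y) = Poly_Mapping.single 0 r * (x * y)"
    for x y :: "'g ncpoly" and r
    by (metis mult.assoc mult_scalar_commute)
  then show ?thesis
    by unfold_locales
      (simp_all add: scale_eq_mult distrib_left distrib_right single_add mult_single
        mult.assoc[symmetric])
qed

interpretation free: cx_algebra "free_algebra :: (complex, 'g ncpoly) module"
  by (rule free_cx_algebra)

lemma free_scalar_ideal: "scalar_ideal (Idl\<^bsub>free_algebra\<^esub> R) free_algebra scale"
proof -
  interpret ideal "Idl\<^bsub>free_algebra\<^esub> R" free_algebra
    by (rule free.genideal_ideal) simp
  show ?thesis
  proof unfold_locales
    fix x r assume "x \<in> Idl\<^bsub>free_algebra\<^esub> R"
    then show "scale r x \<in> Idl\<^bsub>free_algebra\<^esub> R"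
      using I_l_closed[of x "Poly_Mapping.single 0 r"] by (simp add: scale_eq_mult)
  qed (simp_all add: free.smult_add_right[simplified] free.smult_add_left[simplified]
      free.smult_smult[simplified] free.smult_one[simplified] free.smult_mult_left[simplified]
      free.smult_mult_right[simplified])
qed

lemma presented_eq_quotient:
  "presented_algebra R = quotient_algebra free_algebra (Idl\<^bsub>free_algebra\<^esub> R) scale"
  by (simp add: presented_algebra_def quotient_algebra_def Let_def)

lemma presented_cx_algebra: "cx_algebra (presented_algebra R)"
  unfolding presented_eq_quotient by (rule scalar_ideal.quotient_cx_algebra[OF free_scalar_ideal])

lemma presented_gen_closed [simp]: "presented_gen R g \<in> carrier (presented_algebra R)"
  unfolding presented_eq_quotient presented_gen_def
  by (rule scalar_ideal.coset_closed[OF free_scalar_ideal]) simp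

lemma single_Cons:
  "Poly_Mapping.single (Word (g # gs)) 1 = var g * Poly_Mapping.single (Word gs) (1 :: complex)"
  by (simp add: var_def mult_single plus_word_def)

lemma single_eq_scale: "Poly_Mapping.single w c = scale c (Poly_Mapping.single w 1)"
  by (simp add: scale_eq_mult mult_single)

lemma single_Nil: "Poly_Mapping.single (Word []) (1 :: complex) = 1"
  by (simp add: zero_word_def[symmetric])

lemma free_algebra_hom_eqI:
  assumes f: "f \<in> algebra_hom free_algebra B" and f': "f' \<in> algebra_hom free_algebra B"
    and var: "\<And>g. f (var g) = f' (var g)"
  shows "f p = f' p"
proof (induction p rule: ncpoly_induct)
  case (single w c)
  have "f (Poly_Mapping.single (Word gs) 1) = f' (Poly_Mapping.single (Word gs) 1)" for gs
  proof (induction gs)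
    case Nil
    show ?case
      using algebra_homD(4)[OF f] algebra_homD(4)[OF f'] by (simp add: single_Nil)
  next
    case (Cons g gs)
    then show ?case
      using algebra_homD(3)[OF f] algebra_homD(3)[OF f'] by (simp add: single_Cons var)
  qed
  from this[of "letters w"] show ?case
    using algebra_homD(5)[OF f] algebra_homD(5)[OF f'] by (simp add: single_eq_scale[of w c])
next
  case (add p q)
  then show ?case
    using algebra_homD(2)[OF f] algebra_homD(2)[OF f'] by simp
qed

lemma presented_proj_hom:
  "(\<lambda>p. (Idl\<^bsub>free_algebra\<^esub> R) +>\<^bsub>free_algebra\<^esub> p) \<in> algebra_hom free_algebra (presented_algebra R)"
proof -
  interpret scalar_ideal "Idl\<^bsub>free_algebra\<^esub> R" free_algebra scale
    by (rule free_scalar_ideal)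
  show ?thesis
    unfolding presented_eq_quotient
    using quotient_add quotient_mult quotient_one quotient_smult coset_closed
    by (intro algebra_homI) simp_all
qed

lemma presented_rel_zero:
  assumes "p \<in> R"
  shows "(Idl\<^bsub>free_algebra\<^esub> R) +>\<^bsub>free_algebra\<^esub> p = \<zero>\<^bsub>presented_algebra R\<^esub>"
proof -
  interpret scalar_ideal "Idl\<^bsub>free_algebra\<^esub> R" free_algebra scale
    by (rule free_scalar_ideal)
  have "p \<in> Idl\<^bsub>free_algebra\<^esub> R"
    using free.genideal_self[of R] assms by auto
  then show ?thesis
    unfolding presented_eq_quotient quotient_zero using coset_eqI[of 0 p] by simp
qed

lemma presented_rel_eq:
  assumes "p - q \<in> R"
  shows "(Idl\<^bsub>free_algebra\<^esub> R) +>\<^bsub>free_algebra\<^esub> p = (Idl\<^bsub>free_algebra\<^esub> R) +>\<^bsub>free_algebra\<^esub> q"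
proof -
  interpret P: cx_algebra "presented_algebra R" by (rule presented_cx_algebra)
  note hom = algebra_homD[OF presented_proj_hom[of R], simplified]
  from hom(2)[of "p - q" q] show ?thesis
    by (simp add: hom(1) presented_rel_zero[OF assms])
qed

lemma presented_algebra_hom_eqI:
  assumes f: "f \<in> algebra_hom (presented_algebra R) B" "f' \<in> algebra_hom (presented_algebra R) B"
    and gen: "\<And>g. f (presented_gen R g) = f' (presented_gen R g)"
    and x: "x \<in> carrier (presented_algebra R)"
  shows "f x = f' x"
proof -
  interpret scalar_ideal "Idl\<^bsub>free_algebra\<^esub> R" free_algebra scale
    by (rule free_scalar_ideal)
  obtain p where "x = (Idl\<^bsub>free_algebra\<^esub> R) +>\<^bsub>free_algebra\<^esub> p"
    using x unfolding presented_eq_quotient carrier_quotient by auto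
  with free_algebra_hom_eqI[OF algebra_hom_compose[OF presented_proj_hom f(1)]
      algebra_hom_compose[OF presented_proj_hom f(2)], of p] gen
  show ?thesis by (simp add: presented_gen_def)
qed

text \<open>Substitution of elements of an algebra for the variables of a noncommutative polynomial.\<close>

definition free_eval :: "(complex, 'b) module \<Rightarrow> ('g \<Rightarrow> 'b) \<Rightarrow> 'g ncpoly \<Rightarrow> 'b" where
  "free_eval B h p =
     (\<Oplus>\<^bsub>B\<^esub>w\<in>Poly_Mapping.keys p.
        Poly_Mapping.lookup p w \<odot>\<^bsub>B\<^esub> foldr (\<lambda>g x. h g \<otimes>\<^bsub>B\<^esub> x) (letters w) \<one>\<^bsub>B\<^esub>)"

context cx_algebra
begin

context
  fixes h :: "'g \<Rightarrow> 'a"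
  assumes h [simp]: "\<And>g. h g \<in> carrier A"
begin

abbreviation word_value where "word_value gs \<equiv> foldr (\<lambda>g x. h g \<otimes> x) gs \<one>"

lemma word_value_closed [simp]: "word_value gs \<in> carrier A"
  by (induction gs) simp_all

lemma word_value_append: "word_value (gs @ gs') = word_value gs \<otimes> word_value gs'"
proof (induction gs)
  case (Cons g gs)
  then show ?case by (simp add: m_assoc del: foldr_append)
qed simp

lemma free_eval_add: "free_eval A h (p + q) = free_eval A h p \<oplus> free_eval A h q"
  unfolding free_eval_def
  by (rule finsum_keys_add[where S = UNIV]) (simp_all add: smult_add_left)

lemma free_eval_single: "free_eval A h (Poly_Mapping.single w c) = c \<odot> word_value (letters w)"
  by (simp add: free_eval_def)

lemma free_eval_closed [simp]: "free_eval A h p \<in> carrier A"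
  by (simp add: free_eval_def)

lemma free_eval_mult: "free_eval A h (p * q) = free_eval A h p \<otimes> free_eval A h q"
proof (induction p rule: ncpoly_induct)
  case (single w c)
  show ?case
  proof (induction q rule: ncpoly_induct)
    case (single w' c')
    show ?case
      by (simp add: mult_single free_eval_single plus_word_def word_value_append smult_mult_left
          smult_mult_right smult_smult mult.commute[of c] del: foldr_append)
  qed (simp add: distrib_left free_eval_add r_distr)
qed (simp add: distrib_right free_eval_add l_distr)

lemma free_eval_hom: "free_eval A h \<in> algebra_hom free_algebra A"
proof (rule algebra_homI)
  have one: "free_eval A h (Poly_Mapping.single 0 r) = r \<odot> \<one>" for r
    by (simp add: free_eval_single zero_word_def)
  from one[of 1] show "free_eval A h \<one>\<^bsub>free_algebra\<^esub> = \<one>" by simp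
  show "free_eval A h (r \<odot>\<^bsub>free_algebra\<^esub> p) = r \<odot> free_eval A h p" for r p
    by (simp add: scale_eq_mult free_eval_mult one smult_mult_left)
qed (simp_all add: free_eval_add free_eval_mult)

lemma free_eval_var [simp]: "free_eval A h (var g) = h g"
  by (simp add: var_def free_eval_single)

lemma free_eval_scale [simp]: "free_eval A h (scale r p) = r \<odot> free_eval A h p"
  using algebra_homD(5)[OF free_eval_hom, of p r] by simp

lemma free_eval_diff_eq_zero_iff:
  "free_eval A h (p - q) = \<zero> \<longleftrightarrow> free_eval A h p = free_eval A h q"
proof -
  have "free_eval A h p = free_eval A h (p - q) \<oplus> free_eval A h q"
    by (simp add: free_eval_add[symmetric])
  then show ?thesis
    by (metis free_eval_closed l_zero add.right_cancel zero_closed)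
qed

end

end

text \<open>
  The kernel of an evaluation is an ideal, so if it contains the relations, then it contains the ideal
  generated by them, and the evaluation is constant on cosets.
\<close>

lemma presented_algebra_lift:
  assumes B: "cx_algebra B" and h: "\<And>g. h g \<in> carrier B"
    and rels: "\<And>p. p \<in> R \<Longrightarrow> free_eval B h p = \<zero>\<^bsub>B\<^esub>"
  shows "\<exists>f\<in>algebra_hom (presented_algebra R) B. \<forall>g. f (presented_gen R g) = h g"
proof -
  let ?I = "Idl\<^bsub>free_algebra\<^esub> R" and ?e = "free_eval B h"
  note e = cx_algebra.free_eval_add[OF B, of h, OF h] cx_algebra.free_eval_mult[OF B, of h, OF h]
    cx_algebra.free_eval_scale[OF B, of h, OF h] cx_algebra.free_eval_closed[OF B, of h, OF h]
  note e_hom = cx_algebra.free_eval_hom[OF B, of h, OF h]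
  interpret B: cx_algebra B by (rule B)
  interpret scalar_ideal ?I free_algebra scale
    by (rule free_scalar_ideal)
  have "?e \<in> ring_hom free_algebra B"
    using e_hom unfolding algebra_hom_def by blast
  then have hom: "ring_hom_ring free_algebra B ?e"
    by (rule ring_hom_ringI2[OF free.ring_axioms B.ring_axioms])
  have "?I \<subseteq> a_kernel free_algebra B ?e"
    by (rule free.genideal_minimal[OF ring_hom_ring.kernel_is_ideal[OF hom]]) (auto simp: a_kernel_def' rels)
  then have zero: "?e i = \<zero>\<^bsub>B\<^esub>" if "i \<in> ?I" for i
    using that by (auto simp: a_kernel_def')
  define f where "f X = the_elem (?e ` X)" for X
  have f: "f (?I +>\<^bsub>free_algebra\<^esub> p) = ?e p" for p
    unfolding f_def by (rule the_elem_image_coset) (simp_all add: e zero)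
  have "f \<in> algebra_hom (presented_algebra R) B"
    unfolding presented_eq_quotient
  proof (rule algebra_homI)
    fix X Y assume "X \<in> carrier Q" "Y \<in> carrier Q"
    then obtain p p' where "X = ?I +>\<^bsub>free_algebra\<^esub> p" "Y = ?I +>\<^bsub>free_algebra\<^esub> p'"
      by (auto simp: carrier_quotient)
    then show "f (X \<oplus>\<^bsub>Q\<^esub> Y) = f X \<oplus>\<^bsub>B\<^esub> f Y" "f (X \<otimes>\<^bsub>Q\<^esub> Y) = f X \<otimes>\<^bsub>B\<^esub> f Y"
      using quotient_add[of p p'] quotient_mult[of p p']
      by (simp_all add: f e)
  next
    fix X r assume "X \<in> carrier Q"
    then obtain p where "X = ?I +>\<^bsub>free_algebra\<^esub> p"
      by (auto simp: carrier_quotient)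
    then show "f X \<in> carrier B" "f (r \<odot>\<^bsub>Q\<^esub> X) = r \<odot>\<^bsub>B\<^esub> f X"
      using quotient_smult[of p r] by (simp_all add: f e)
  next
    show "f \<one>\<^bsub>Q\<^esub> = \<one>\<^bsub>B\<^esub>"
      using algebra_homD(4)[OF e_hom] quotient_one by (simp add: f)
  qed
  then show ?thesis
    by (intro bexI[of _ f]) (simp_all add: presented_gen_def f cx_algebra.free_eval_var[OF B, of h, OF h])
qed

section \<open>The tensor product of two algebras\<close>

text \<open>
  There is no linearity over the complex numbers here: a balanced map induces an additive map on the
  tensor product, and compatibility with scalars is a separate property of this map.
\<close>

definition balanced ::
  "(complex, 'a) module \<Rightarrow> (complex, 'b) module \<Rightarrow> (complex, 'c) module \<Rightarrow> ('a \<Rightarrow> 'b \<Rightarrow> 'c) \<Rightarrow> bool" where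
  "balanced A B M \<phi> \<longleftrightarrow>
     (\<forall>x\<in>carrier A. \<forall>y\<in>carrier B. \<phi> x y \<in> carrier M) \<and>
     (\<forall>x\<in>carrier A. \<forall>x'\<in>carrier A. \<forall>y\<in>carrier B. \<phi> (x \<oplus>\<^bsub>A\<^esub> x') y = \<phi> x y \<oplus>\<^bsub>M\<^esub> \<phi> x' y) \<and>
     (\<forall>x\<in>carrier A. \<forall>y\<in>carrier B. \<forall>y'\<in>carrier B. \<phi> x (y \<oplus>\<^bsub>B\<^esub> y') = \<phi> x y \<oplus>\<^bsub>M\<^esub> \<phi> x y') \<and>
     (\<forall>r. \<forall>x\<in>carrier A. \<forall>y\<in>carrier B. \<phi> (r \<odot>\<^bsub>A\<^esub> x) y = \<phi> x (r \<odot>\<^bsub>B\<^esub> y))"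

text \<open>
  Formal integral sums of pairs are the monoid ring of the multiplicative monoid of \<open>A \<times> B\<close>.
  Associativity and distributivity hold on this level, and the tensor algebra inherits them as its
  quotient by an ideal.
\<close>

definition pair_ring ::
  "(complex, 'a) module \<Rightarrow> (complex, 'b) module \<Rightarrow> ('a \<times> 'b \<Rightarrow>\<^sub>0 int) ring" where
  "pair_ring A B =
     \<lparr>carrier = carrier (pair_group A B), monoid.mult = pair_mult A B,
      one = frag_of (\<one>\<^bsub>A\<^esub>, \<one>\<^bsub>B\<^esub>), ring.zero = 0, add = (+)\<rparr>"

lemma pair_ring_simps [simp]:
  "carrier (pair_ring A B) = {u. Poly_Mapping.keys u \<subseteq> carrier A \<times> carrier B}"
  "u \<otimes>\<^bsub>pair_ring A B\<^esub> v = pair_mult A B u v"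
  "\<one>\<^bsub>pair_ring A B\<^esub> = frag_of (\<one>\<^bsub>A\<^esub>, \<one>\<^bsub>B\<^esub>)"
  "\<zero>\<^bsub>pair_ring A B\<^esub> = 0"
  "u \<oplus>\<^bsub>pair_ring A B\<^esub> v = u + v"
  by (auto simp: pair_ring_def)

lemma pair_mult_of [simp]:
  "pair_mult A B (frag_of (x, y)) (frag_of (x', y')) = frag_of (x \<otimes>\<^bsub>A\<^esub> x', y \<otimes>\<^bsub>B\<^esub> y')"
  by (simp add: pair_mult_def)

lemma pair_mult_diff_left: "pair_mult A B (u - v) w = pair_mult A B u w - pair_mult A B v w"
  by (simp add: pair_mult_def frag_extend_diff)

lemma pair_mult_add_left: "pair_mult A B (u + v) w = pair_mult A B u w + pair_mult A B v w"
  by (simp add: pair_mult_def frag_extend_add)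

lemma pair_mult_zero_left [simp]: "pair_mult A B 0 w = 0"
  by (simp add: pair_mult_def)

lemma pair_mult_zero_right [simp]: "pair_mult A B u 0 = 0"
  using subset_UNIV[of "Poly_Mapping.keys u"]
  by (induction u rule: frag_induction) (auto simp: pair_mult_diff_left, simp add: pair_mult_def)

lemma pair_mult_diff_right: "pair_mult A B u (v - w) = pair_mult A B u v - pair_mult A B u w"
  using subset_UNIV[of "Poly_Mapping.keys u"]
  by (induction u rule: frag_induction)
    (auto simp: pair_mult_diff_left, auto simp: pair_mult_def frag_extend_diff)

lemma pair_mult_add_right: "pair_mult A B u (v + w) = pair_mult A B u v + pair_mult A B u w"
  using pair_mult_diff_right[of A B u "v + w" w] by (simp add: algebra_simps)

lemma pair_scale_of [simp]: "pair_scale A r (frag_of (x, y)) = frag_of (r \<odot>\<^bsub>A\<^esub> x, y)"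
  by (simp add: pair_scale_def)

lemma pair_scale_diff: "pair_scale A r (u - v) = pair_scale A r u - pair_scale A r v"
  by (simp add: pair_scale_def frag_extend_diff)

lemma pair_scale_add: "pair_scale A r (u + v) = pair_scale A r u + pair_scale A r v"
  by (simp add: pair_scale_def frag_extend_add)

lemma pair_scale_zero [simp]: "pair_scale A r 0 = 0"
  by (simp add: pair_scale_def)

locale tensor_pair = A: cx_algebra A + B: cx_algebra B
  for A :: "(complex, 'a) module" and B :: "(complex, 'b) module"
begin

abbreviation pairs where "pairs \<equiv> carrier A \<times> carrier B"
abbreviation null where "null \<equiv> tensor_null A B"
abbreviation tensor where "tensor \<equiv> tensor_algebra A B"
abbreviation pure where "pure \<equiv> pure_tensor A B"

lemma keys_diff_pairs:
  "\<lbrakk>Poly_Mapping.keys u \<subseteq> pairs; Poly_Mapping.keys v \<subseteq> pairs\<rbrakk> \<Longrightarrow> Poly_Mapping.keys (u - v) \<subseteq> pairs"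
  using keys_diff[of u v] by blast

lemma pair_mult_closed:
  assumes u: "Poly_Mapping.keys u \<subseteq> pairs" and v: "Poly_Mapping.keys v \<subseteq> pairs"
  shows "Poly_Mapping.keys (pair_mult A B u v) \<subseteq> pairs"
  using u
proof (induction u rule: frag_induction)
  case (one k)
  from v show ?case
    using one by (induction v rule: frag_induction)
      (auto simp: pair_mult_diff_right keys_diff_pairs)
qed (auto simp: pair_mult_diff_left keys_diff_pairs)

lemma pair_scale_closed:
  assumes u: "Poly_Mapping.keys u \<subseteq> pairs"
  shows "Poly_Mapping.keys (pair_scale A r u) \<subseteq> pairs"
  using u by (induction u rule: frag_induction) (auto simp: pair_scale_diff keys_diff_pairs)

lemma pair_mult_assoc:
  assumes u: "Poly_Mapping.keys u \<subseteq> pairs" and v: "Poly_Mapping.keys v \<subseteq> pairs"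
    and w: "Poly_Mapping.keys w \<subseteq> pairs"
  shows "pair_mult A B (pair_mult A B u v) w = pair_mult A B u (pair_mult A B v w)"
  using u
proof (induction u rule: frag_induction)
  case u: (one k)
  from v show ?case
  proof (induction v rule: frag_induction)
    case v: (one l)
    from w show ?case
      using u v by (induction w rule: frag_induction)
        (auto simp: pair_mult_diff_right A.m_assoc B.m_assoc)
  qed (simp_all add: pair_mult_diff_left pair_mult_diff_right)
qed (simp_all add: pair_mult_diff_left)

lemma pair_ring: "ring (pair_ring A B)"
proof (rule ringI)
  show "abelian_group (pair_ring A B)"
  proof (rule abelian_groupI)
    fix u assume "u \<in> carrier (pair_ring A B)"
    then show "\<exists>v\<in>carrier (pair_ring A B). v \<oplus>\<^bsub>pair_ring A B\<^esub> u = \<zero>\<^bsub>pair_ring A B\<^esub>"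
      by (intro bexI[of _ "- u"]) simp_all
  next
    fix u v assume "u \<in> carrier (pair_ring A B)" "v \<in> carrier (pair_ring A B)"
    then show "u \<oplus>\<^bsub>pair_ring A B\<^esub> v \<in> carrier (pair_ring A B)"
      using keys_add[of u v] by auto
  qed (simp_all add: add_ac)
  have one: "pair_mult A B (frag_of (\<one>\<^bsub>A\<^esub>, \<one>\<^bsub>B\<^esub>)) u = u" "pair_mult A B u (frag_of (\<one>\<^bsub>A\<^esub>, \<one>\<^bsub>B\<^esub>)) = u"
    if "Poly_Mapping.keys u \<subseteq> pairs" for u
    using that
    by (induction u rule: frag_induction) (auto simp: pair_mult_diff_left pair_mult_diff_right)
  show "Group.monoid (pair_ring A B)"
    by (rule monoidI) (simp_all add: pair_mult_closed pair_mult_assoc one)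
qed (simp_all add: pair_mult_add_left pair_mult_add_right)

lemma rels_subset: "tensor_rels A B \<subseteq> carrier (pair_group A B)"
  unfolding tensor_rels_def by (rule subsetI, elim UnE CollectE exE conjE) (simp_all add: keys_diff_pairs)

lemma null_subgroup: "subgroup null (pair_group A B)"
  unfolding tensor_null_def by (rule group.generate_is_subgroup[OF _ rels_subset]) simp

lemma null_keys: "u \<in> null \<Longrightarrow> Poly_Mapping.keys u \<subseteq> pairs"
  using subgroup.mem_carrier[OF null_subgroup] by simp

lemma null_zero [simp]: "0 \<in> null"
  using subgroup.one_closed[OF null_subgroup] by simp

lemma null_add: "\<lbrakk>u \<in> null; v \<in> null\<rbrakk> \<Longrightarrow> u + v \<in> null"
  using subgroup.m_closed[OF null_subgroup] by simp

lemma null_uminus: "u \<in> null \<Longrightarrow> - u \<in> null"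
  using subgroup.m_inv_closed[OF null_subgroup, of u] null_keys[of u] by simp

lemma null_diff: "\<lbrakk>u \<in> null; v \<in> null\<rbrakk> \<Longrightarrow> u - v \<in> null"
  using null_add[of u "- v"] null_uminus[of v] by simp

lemma null_add_left:
  "\<lbrakk>x \<in> carrier A; x' \<in> carrier A; y \<in> carrier B\<rbrakk> \<Longrightarrow>
    frag_of (x \<oplus>\<^bsub>A\<^esub> x', y) - frag_of (x, y) - frag_of (x', y) \<in> null"
  unfolding tensor_null_def tensor_rels_def by (rule generate.incl) blast

lemma null_add_right:
  "\<lbrakk>x \<in> carrier A; y \<in> carrier B; y' \<in> carrier B\<rbrakk> \<Longrightarrow>
    frag_of (x, y \<oplus>\<^bsub>B\<^esub> y') - frag_of (x, y) - frag_of (x, y') \<in> null"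
  unfolding tensor_null_def tensor_rels_def by (rule generate.incl) blast

lemma null_smult:
  "\<lbrakk>x \<in> carrier A; y \<in> carrier B\<rbrakk> \<Longrightarrow> frag_of (r \<odot>\<^bsub>A\<^esub> x, y) - frag_of (x, r \<odot>\<^bsub>B\<^esub> y) \<in> null"
  unfolding tensor_null_def tensor_rels_def by (rule generate.incl) blast

text \<open>
  Differences express both inverses and products of the group of formal sums, so a single closure
  condition suffices.
\<close>

lemma null_induct [consumes 1, case_names zero diff add_left add_right smult]:
  assumes u: "u \<in> null" and zero: "P 0"
    and diff: "\<And>u v. \<lbrakk>u \<in> null; v \<in> null; P u; P v\<rbrakk> \<Longrightarrow> P (u - v)"
    and add_left: "\<And>x x' y. \<lbrakk>x \<in> carrier A; x' \<in> carrier A; y \<in> carrier B\<rbrakk> \<Longrightarrow>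
      P (frag_of (x \<oplus>\<^bsub>A\<^esub> x', y) - frag_of (x, y) - frag_of (x', y))"
    and add_right: "\<And>x y y'. \<lbrakk>x \<in> carrier A; y \<in> carrier B; y' \<in> carrier B\<rbrakk> \<Longrightarrow>
      P (frag_of (x, y \<oplus>\<^bsub>B\<^esub> y') - frag_of (x, y) - frag_of (x, y'))"
    and smult: "\<And>r x y. \<lbrakk>x \<in> carrier A; y \<in> carrier B\<rbrakk> \<Longrightarrow>
      P (frag_of (r \<odot>\<^bsub>A\<^esub> x, y) - frag_of (x, r \<odot>\<^bsub>B\<^esub> y))"
  shows "P u"
proof -
  have rels: "P v" if "v \<in> tensor_rels A B" for v
    using that unfolding tensor_rels_def by (auto intro: add_left add_right smult)
  have "u \<in> null \<and> P u"
    using u unfolding tensor_null_def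
  proof (induction u rule: generate.induct)
    case one
    show ?case using zero null_zero by (simp add: tensor_null_def)
  next
    case (incl h)
    then show ?case using rels by (simp add: generate.incl)
  next
    case (inv h)
    then have h: "h \<in> null"
      by (simp add: tensor_null_def generate.incl)
    have "P (0 - h)" "0 - h \<in> null"
      using diff[OF null_zero h zero rels[OF inv]] null_uminus[OF h] by simp_all
    then show ?case using null_keys[OF h] by (simp add: tensor_null_def)
  next
    case (eng h h')
    then have h: "h \<in> null" "h' \<in> null"
      by (simp_all add: tensor_null_def)
    have "P (h - (0 - h'))"
      using eng h zero null_uminus by (intro diff) simp_all
    then show ?case using null_add[OF h] by (simp add: tensor_null_def)
  qed
  then show ?thesis ..
qed

text \<open>
  Multiplication by a single pair \<open>(a, b)\<close> sends each defining relation of the tensor product to a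
  relation of the same kind, by distributivity and by compatibility of scalars with products. So
  the relations generate an ideal already as an additive group.
\<close>

lemma null_mult:
  assumes v: "v \<in> null" and u: "Poly_Mapping.keys u \<subseteq> pairs"
  shows "pair_mult A B u v \<in> null \<and> pair_mult A B v u \<in> null"
  using u
proof (induction u rule: frag_induction)
  case zero
  show ?case by simp
next
  case (diff a b)
  then show ?case by (simp add: pair_mult_diff_left pair_mult_diff_right null_diff)
next
  case (one k)
  then obtain a b where k: "k = (a, b)" and a: "a \<in> carrier A" and b: "b \<in> carrier B"
    by auto
  from v show ?case
  proof (induction v rule: null_induct)
    case zero
    show ?case by simp
  next
    case (diff u v)
    then show ?case by (simp add: pair_mult_diff_left pair_mult_diff_right null_diff)
  next
    case (add_left x x' y)
    with a b show ?case
      using null_add_left[of "a \<otimes>\<^bsub>A\<^esub> x" "a \<otimes>\<^bsub>A\<^esub> x'" "b \<otimes>\<^bsub>B\<^esub> y"]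
        null_add_left[of "x \<otimes>\<^bsub>A\<^esub> a" "x' \<otimes>\<^bsub>A\<^esub> a" "y \<otimes>\<^bsub>B\<^esub> b"]
      by (simp add: k pair_mult_diff_left pair_mult_diff_right A.l_distr A.r_distr)
  next
    case (add_right x y y')
    with a b show ?case
      using null_add_right[of "a \<otimes>\<^bsub>A\<^esub> x" "b \<otimes>\<^bsub>B\<^esub> y" "b \<otimes>\<^bsub>B\<^esub> y'"]
        null_add_right[of "x \<otimes>\<^bsub>A\<^esub> a" "y \<otimes>\<^bsub>B\<^esub> b" "y' \<otimes>\<^bsub>B\<^esub> b"]
      by (simp add: k pair_mult_diff_left pair_mult_diff_right B.l_distr B.r_distr)
  next
    case (smult r x y)
    with a b show ?case
      using null_smult[of "a \<otimes>\<^bsub>A\<^esub> x" "b \<otimes>\<^bsub>B\<^esub> y" r] null_smult[of "x \<otimes>\<^bsub>A\<^esub> a" "y \<otimes>\<^bsub>B\<^esub> b" r]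
      by (simp add: k pair_mult_diff_left pair_mult_diff_right A.smult_mult_left
          A.smult_mult_right B.smult_mult_left B.smult_mult_right)
  qed
qed

lemma null_scale:
  assumes "u \<in> null"
  shows "pair_scale A r u \<in> null"
  using assms
proof (induction u rule: null_induct)
  case (add_left x x' y)
  then show ?case
    using null_add_left[of "r \<odot>\<^bsub>A\<^esub> x" "r \<odot>\<^bsub>A\<^esub> x'" y] by (simp add: pair_scale_diff A.smult_add_right)
next
  case (add_right x y y')
  then show ?case
    using null_add_right[of "r \<odot>\<^bsub>A\<^esub> x" y y'] by (simp add: pair_scale_diff)
next
  case (smult s x y)
  then show ?case
    using null_smult[of "r \<odot>\<^bsub>A\<^esub> x" y s] by (simp add: pair_scale_diff A.smult_smult mult.commute)
qed (simp_all add: pair_scale_diff null_diff)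

lemma null_ideal: "ideal null (pair_ring A B)"
proof (rule idealI[OF pair_ring])
  have "add_monoid (pair_ring A B) = pair_group A B"
    by (simp add: pair_ring_def free_Abelian_group_def)
  with null_subgroup show "subgroup null (add_monoid (pair_ring A B))"
    by simp
qed (use null_mult in simp_all)

lemma coset_eq_tensor_class: "null +>\<^bsub>pair_ring A B\<^esub> u = tensor_class A B u"
  by (simp add: tensor_class_def a_r_coset_def r_coset_def)

lemma null_scalar_ideal: "scalar_ideal null (pair_ring A B) (pair_scale A)"
proof -
  interpret I: ideal null "pair_ring A B" by (rule null_ideal)
  have coset_eqI: "null +>\<^bsub>pair_ring A B\<^esub> u = null +>\<^bsub>pair_ring A B\<^esub> v"
    if "u - v \<in> null" "Poly_Mapping.keys u \<subseteq> pairs" "Poly_Mapping.keys v \<subseteq> pairs" for u v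
  proof (rule I.a_repr_independence[symmetric])
    show "u \<in> null +>\<^bsub>pair_ring A B\<^esub> v"
      using that by (auto simp: a_r_coset_def r_coset_def intro!: bexI[of _ "u - v"])
  qed (use that I.a_subgroup in simp_all)
  have add: "pair_scale A (r + s) u - (pair_scale A r u + pair_scale A s u) \<in> null"
    if "Poly_Mapping.keys u \<subseteq> pairs" for u r s
    using that
  proof (induction u rule: frag_induction)
    case (one k)
    then show ?case
      using null_add_left[of "r \<odot>\<^bsub>A\<^esub> fst k" "s \<odot>\<^bsub>A\<^esub> fst k" "snd k"]
      by (auto simp: A.smult_add_left diff_diff_eq)
  next
    case (diff u v)
    from null_diff[OF diff] show ?case
      by (simp add: pair_scale_diff algebra_simps)
  qed simp
  have scalar: "pair_scale A r (pair_scale A s u) = pair_scale A (r * s) u"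
    if "Poly_Mapping.keys u \<subseteq> pairs" for u r s
    using that by (induction u rule: frag_induction) (auto simp: pair_scale_diff A.smult_smult)
  have one: "pair_scale A 1 u = u" if "Poly_Mapping.keys u \<subseteq> pairs" for u
    using that by (induction u rule: frag_induction) (auto simp: pair_scale_diff)
  have mult: "pair_mult A B (pair_scale A r u) v = pair_scale A r (pair_mult A B u v)"
    "pair_mult A B u (pair_scale A r v) = pair_scale A r (pair_mult A B u v)"
    if u: "Poly_Mapping.keys u \<subseteq> pairs" and v: "Poly_Mapping.keys v \<subseteq> pairs" for u v r
    using u
  proof (induction u rule: frag_induction)
    case (one k)
    case 1
    from v show ?case
      using one by (induction v rule: frag_induction)
        (auto simp: pair_scale_diff pair_mult_diff_right A.smult_mult_left)
    case 2
    from v show ?case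
      using one by (induction v rule: frag_induction)
        (auto simp: pair_scale_diff pair_mult_diff_right A.smult_mult_right)
  qed (simp_all add: pair_scale_diff pair_mult_diff_left)
  have closed_add: "Poly_Mapping.keys (u + v) \<subseteq> pairs"
    if "Poly_Mapping.keys u \<subseteq> pairs" "Poly_Mapping.keys v \<subseteq> pairs" for u v
    using that keys_add[of u v] by blast
  show ?thesis
  proof unfold_locales
    fix u r s assume "u \<in> carrier (pair_ring A B)"
    then show "null +>\<^bsub>pair_ring A B\<^esub> pair_scale A (r + s) u =
        null +>\<^bsub>pair_ring A B\<^esub> (pair_scale A r u \<oplus>\<^bsub>pair_ring A B\<^esub> pair_scale A s u)"
      unfolding pair_ring_simps
      by (intro coset_eqI add closed_add pair_scale_closed) simp_all
  qed (simp_all add: pair_scale_closed null_scale pair_scale_add scalar one mult)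
qed

text \<open>
  The record of the tensor algebra coincides with the generic quotient, whose laws therefore become
  available for it.
\<close>

sublocale quot: scalar_ideal null "pair_ring A B" "pair_scale A"
  rewrites "quotient_algebra (pair_ring A B) null (pair_scale A) = tensor"
    and "carrier (pair_ring A B) = {u. Poly_Mapping.keys u \<subseteq> pairs}"
    and "\<And>u v. u \<otimes>\<^bsub>pair_ring A B\<^esub> v = pair_mult A B u v"
    and "\<And>u v. u \<oplus>\<^bsub>pair_ring A B\<^esub> v = u + v"
    and "\<one>\<^bsub>pair_ring A B\<^esub> = frag_of (\<one>\<^bsub>A\<^esub>, \<one>\<^bsub>B\<^esub>)"
    and "\<zero>\<^bsub>pair_ring A B\<^esub> = 0"
    and "\<And>u. null +>\<^bsub>pair_ring A B\<^esub> u = tensor_class A B u"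
proof -
  show "quotient_algebra (pair_ring A B) null (pair_scale A) = tensor"
    unfolding quotient_algebra_def tensor_algebra_def FactRing_def FactGroup_def
    by (auto simp: ring.defs module.defs coset_eq_tensor_class rcoset_mult_def A_RCOSETS_def RCOSETS_def
        r_coset_def set_mult_def set_add_def pure_tensor_def tensor_class_def fun_eq_iff
        a_r_coset_def) blast
qed (simp_all add: null_scalar_ideal coset_eq_tensor_class)

lemma tensor_cx_algebra: "cx_algebra tensor"
  by (rule quot.quotient_cx_algebra)

sublocale T: cx_algebra tensor
  by (rule tensor_cx_algebra)

lemma class_eqI:
  assumes "u - v \<in> null" "Poly_Mapping.keys v \<subseteq> pairs"
  shows "tensor_class A B u = tensor_class A B v"
  using quot.coset_eqI[of v "u - v"] assms by simp

lemma pure_closed [simp]: "\<lbrakk>x \<in> carrier A; y \<in> carrier B\<rbrakk> \<Longrightarrow> pure x y \<in> carrier tensor"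
  unfolding pure_tensor_def by (rule quot.coset_closed) simp

lemma pure_add_left:
  assumes "x \<in> carrier A" "x' \<in> carrier A" "y \<in> carrier B"
  shows "pure (x \<oplus>\<^bsub>A\<^esub> x') y = pure x y \<oplus>\<^bsub>tensor\<^esub> pure x' y"
proof -
  have "pure (x \<oplus>\<^bsub>A\<^esub> x') y = tensor_class A B (frag_of (x, y) + frag_of (x', y))"
    unfolding pure_tensor_def using null_add_left[OF assms] keys_add[of "frag_of (x, y)" "frag_of (x', y)"] assms
    by (intro class_eqI) (auto simp: diff_diff_eq)
  then show ?thesis
    using assms by (simp add: pure_tensor_def quot.quotient_add)
qed

lemma pure_add_right:
  assumes "x \<in> carrier A" "y \<in> carrier B" "y' \<in> carrier B"
  shows "pure x (y \<oplus>\<^bsub>B\<^esub> y') = pure x y \<oplus>\<^bsub>tensor\<^esub> pure x y'"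
proof -
  have "pure x (y \<oplus>\<^bsub>B\<^esub> y') = tensor_class A B (frag_of (x, y) + frag_of (x, y'))"
    unfolding pure_tensor_def using null_add_right[OF assms] keys_add[of "frag_of (x, y)" "frag_of (x, y')"] assms
    by (intro class_eqI) (auto simp: diff_diff_eq)
  then show ?thesis
    using assms by (simp add: pure_tensor_def quot.quotient_add)
qed

lemma pure_smult_left:
  "\<lbrakk>x \<in> carrier A; y \<in> carrier B\<rbrakk> \<Longrightarrow> pure (r \<odot>\<^bsub>A\<^esub> x) y = r \<odot>\<^bsub>tensor\<^esub> pure x y"
  unfolding pure_tensor_def by (subst quot.quotient_smult) simp_all

lemma pure_smult_right:
  assumes "x \<in> carrier A" "y \<in> carrier B"
  shows "pure x (r \<odot>\<^bsub>B\<^esub> y) = r \<odot>\<^bsub>tensor\<^esub> pure x y"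
proof -
  have "pure (r \<odot>\<^bsub>A\<^esub> x) y = pure x (r \<odot>\<^bsub>B\<^esub> y)"
    unfolding pure_tensor_def using null_smult[OF assms] assms by (intro class_eqI) simp_all
  with assms show ?thesis
    by (simp add: pure_smult_left)
qed

lemma pure_mult:
  "\<lbrakk>x \<in> carrier A; y \<in> carrier B; x' \<in> carrier A; y' \<in> carrier B\<rbrakk> \<Longrightarrow>
    pure x y \<otimes>\<^bsub>tensor\<^esub> pure x' y' = pure (x \<otimes>\<^bsub>A\<^esub> x') (y \<otimes>\<^bsub>B\<^esub> y')"
  unfolding pure_tensor_def by (subst quot.quotient_mult) simp_all

lemma pure_one: "\<one>\<^bsub>tensor\<^esub> = pure \<one>\<^bsub>A\<^esub> \<one>\<^bsub>B\<^esub>"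
  by (simp add: quot.quotient_one pure_tensor_def)

text \<open>
  Sums of pure tensors exhaust the tensor product without subtraction, because the negative of
  \<open>x \<otimes> y\<close> is the pure tensor \<open>(- x) \<otimes> y\<close>. The induction on formal sums works with differences and
  carries the property along for a sum and its negative.
\<close>

lemma tensor_induct [consumes 1, case_names pure add]:
  assumes X: "X \<in> carrier tensor"
    and pure: "\<And>x y. \<lbrakk>x \<in> carrier A; y \<in> carrier B\<rbrakk> \<Longrightarrow> P (pure x y)"
    and add: "\<And>X Y. \<lbrakk>X \<in> carrier tensor; Y \<in> carrier tensor; P X; P Y\<rbrakk> \<Longrightarrow> P (X \<oplus>\<^bsub>tensor\<^esub> Y)"
  shows "P X"
proof -
  obtain u where u: "Poly_Mapping.keys u \<subseteq> pairs" and X: "X = tensor_class A B u"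
    using X unfolding quot.carrier_quotient by auto
  have closed: "tensor_class A B v \<in> carrier tensor" if "Poly_Mapping.keys v \<subseteq> pairs" for v
    using that by (intro quot.coset_closed) simp
  have neg: "tensor_class A B (- v) = \<ominus>\<^bsub>tensor\<^esub> tensor_class A B v"
    if "Poly_Mapping.keys v \<subseteq> pairs" for v
    using that by (intro T.minus_equality[symmetric] closed)
      (simp_all add: quot.quotient_add quot.quotient_zero)
  have "Poly_Mapping.keys u \<subseteq> pairs \<and> P (tensor_class A B u) \<and> P (tensor_class A B (- u))"
    using u
  proof (induction u rule: frag_induction)
    case zero
    have "pure \<zero>\<^bsub>A\<^esub> \<zero>\<^bsub>B\<^esub> = \<zero>\<^bsub>tensor\<^esub>"
      using pure_smult_left[of "\<zero>\<^bsub>A\<^esub>" "\<zero>\<^bsub>B\<^esub>" 0] by simp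
    then show ?case
      using pure[of "\<zero>\<^bsub>A\<^esub>" "\<zero>\<^bsub>B\<^esub>"] by (simp add: quot.quotient_zero)
  next
    case (one k)
    then obtain x y where k: "k = (x, y)" and x: "x \<in> carrier A" and y: "y \<in> carrier B"
      by auto
    have "tensor_class A B (- frag_of k) = pure ((- 1) \<odot>\<^bsub>A\<^esub> x) y"
      using x y by (simp add: k neg pure_tensor_def[symmetric] pure_smult_left T.smult_minus_one)
    then show ?case
      using x y pure[of x y] pure[of "(- 1) \<odot>\<^bsub>A\<^esub> x" y] by (simp add: k pure_tensor_def)
  next
    case (diff a b)
    then have "P (tensor_class A B a \<oplus>\<^bsub>tensor\<^esub> tensor_class A B (- b))"
      "P (tensor_class A B b \<oplus>\<^bsub>tensor\<^esub> tensor_class A B (- a))"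
      by (auto intro!: add closed)
    with diff show ?case
      by (simp add: quot.quotient_add keys_diff_pairs)
  qed
  then show ?thesis by (simp add: X)
qed

text \<open>
  The sum \<open>G u\<close> of the values of \<open>\<phi>\<close> is additive in the formal sum \<open>u\<close> and vanishes on the defining
  relations because \<open>\<phi>\<close> is balanced. Hence it takes a single value on each coset, which is the value
  chosen by \<^const>\<open>tensor_lift\<close>.
\<close>

lemma tensor_lift_pure_add:
  assumes M: "abelian_group M" and \<phi>: "balanced A B M \<phi>"
  shows "\<lbrakk>x \<in> carrier A; y \<in> carrier B\<rbrakk> \<Longrightarrow> tensor_lift M \<phi> (pure x y) = \<phi> x y"
    and "X \<in> carrier tensor \<Longrightarrow> tensor_lift M \<phi> X \<in> carrier M"
    and "\<lbrakk>X \<in> carrier tensor; Y \<in> carrier tensor\<rbrakk> \<Longrightarrow>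
      tensor_lift M \<phi> (X \<oplus>\<^bsub>tensor\<^esub> Y) = tensor_lift M \<phi> X \<oplus>\<^bsub>M\<^esub> tensor_lift M \<phi> Y"
proof -
  interpret M: abelian_group M by (rule M)
  have closed [simp]: "\<phi> x y \<in> carrier M" if "x \<in> carrier A" "y \<in> carrier B" for x y
    using \<phi> that by (simp add: balanced_def)
  have zero [simp]: "[(0::int)] \<cdot>\<^bsub>M\<^esub> x = \<zero>\<^bsub>M\<^esub>" for x
    by (simp add: add_pow_def int_pow_def nat_pow_def)
  define G where "G u = (\<Oplus>\<^bsub>M\<^esub>k\<in>Poly_Mapping.keys u.
      [Poly_Mapping.lookup u k] \<cdot>\<^bsub>M\<^esub> \<phi> (fst k) (snd k))" for u :: "'a \<times> 'b \<Rightarrow>\<^sub>0 int"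
  have G_add: "G (u + v) = G u \<oplus>\<^bsub>M\<^esub> G v"
    if "Poly_Mapping.keys u \<subseteq> pairs" "Poly_Mapping.keys v \<subseteq> pairs" for u v
    unfolding G_def using that
    by (intro M.finsum_keys_add[where S = pairs]) (auto simp: M.add.int_pow_mult)
  have G_closed: "G u \<in> carrier M" if "Poly_Mapping.keys u \<subseteq> pairs" for u
    unfolding G_def using that by (intro M.finsum_closed) auto
  have G_of: "G (frag_of (x, y)) = \<phi> x y" if "x \<in> carrier A" "y \<in> carrier B" for x y
    using that by (simp add: G_def)
  have G_diff: "G (u - v) = G u \<ominus>\<^bsub>M\<^esub> G v"
    if "Poly_Mapping.keys u \<subseteq> pairs" "Poly_Mapping.keys v \<subseteq> pairs" for u v
    using G_add[of "u - v" v] that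
    by (simp add: keys_diff_pairs G_closed M.minus_eq M.a_assoc M.r_neg)
  have G_null: "G u = \<zero>\<^bsub>M\<^esub>" if "u \<in> null" for u
    using that
  proof (induction u rule: null_induct)
    case zero
    show ?case by (simp add: G_def)
  next
    case (diff u v)
    then show ?case by (simp add: G_diff null_keys M.minus_eq)
  next
    case (add_left x x' y)
    then show ?case
      using \<phi> by (simp add: G_diff G_of keys_diff_pairs balanced_def M.minus_eq M.a_ac M.r_neg)
  next
    case (add_right x y y')
    then show ?case
      using \<phi> by (simp add: G_diff G_of keys_diff_pairs balanced_def M.minus_eq M.a_ac M.r_neg)
  next
    case (smult r x y)
    then show ?case
      using \<phi> by (simp add: G_diff G_of balanced_def M.minus_eq M.r_neg)
  qed
  have lift: "tensor_lift M \<phi> (tensor_class A B u) = G u" if "Poly_Mapping.keys u \<subseteq> pairs" for u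
    unfolding tensor_lift_def G_def[symmetric]
    using that by (intro quot.the_elem_image_coset) (simp_all add: G_add G_null G_closed null_keys)
  show "tensor_lift M \<phi> (pure x y) = \<phi> x y" if "x \<in> carrier A" "y \<in> carrier B"
    using that by (simp add: pure_tensor_def lift G_of)
  show "tensor_lift M \<phi> X \<in> carrier M" if "X \<in> carrier tensor"
    using that by (auto simp: quot.carrier_quotient lift G_closed)
  show "tensor_lift M \<phi> (X \<oplus>\<^bsub>tensor\<^esub> Y) = tensor_lift M \<phi> X \<oplus>\<^bsub>M\<^esub> tensor_lift M \<phi> Y"
    if X: "X \<in> carrier tensor" and Y: "Y \<in> carrier tensor"
  proof -
    obtain u where "Poly_Mapping.keys u \<subseteq> pairs" "X = tensor_class A B u"
      using X unfolding quot.carrier_quotient by auto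
    moreover obtain v where "Poly_Mapping.keys v \<subseteq> pairs" "Y = tensor_class A B v"
      using Y unfolding quot.carrier_quotient by auto
    ultimately show ?thesis
      using keys_add[of u v] by (simp add: quot.quotient_add lift G_add subset_trans[OF keys_add])
  qed
qed

lemma tensor_lift_hom:
  assumes M: "cx_algebra M" and \<phi>: "balanced A B M \<phi>"
    and smult: "\<And>r x y. \<lbrakk>x \<in> carrier A; y \<in> carrier B\<rbrakk> \<Longrightarrow> \<phi> (r \<odot>\<^bsub>A\<^esub> x) y = r \<odot>\<^bsub>M\<^esub> \<phi> x y"
    and mult: "\<And>x y x' y'. \<lbrakk>x \<in> carrier A; y \<in> carrier B; x' \<in> carrier A; y' \<in> carrier B\<rbrakk> \<Longrightarrow>
      \<phi> (x \<otimes>\<^bsub>A\<^esub> x') (y \<otimes>\<^bsub>B\<^esub> y') = \<phi> x y \<otimes>\<^bsub>M\<^esub> \<phi> x' y'"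
    and one: "\<phi> \<one>\<^bsub>A\<^esub> \<one>\<^bsub>B\<^esub> = \<one>\<^bsub>M\<^esub>"
  shows "tensor_lift M \<phi> \<in> algebra_hom tensor M"
proof -
  interpret M: cx_algebra M by (rule M)
  note lift = tensor_lift_pure_add[OF M.is_abelian_group \<phi>]
  have closed: "\<phi> x y \<in> carrier M" if "x \<in> carrier A" "y \<in> carrier B" for x y
    using \<phi> that by (simp add: balanced_def)
  show ?thesis
  proof (rule algebra_homI)
    fix X Y assume X: "X \<in> carrier tensor" and Y: "Y \<in> carrier tensor"
    from X show "tensor_lift M \<phi> (X \<otimes>\<^bsub>tensor\<^esub> Y) = tensor_lift M \<phi> X \<otimes>\<^bsub>M\<^esub> tensor_lift M \<phi> Y"
    proof (induction X rule: tensor_induct)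
      case x: (pure x y)
      from Y show ?case
        by (induction Y rule: tensor_induct)
          (simp_all add: x lift mult pure_mult T.r_distr M.r_distr closed)
    next
      case (add X X')
      then show ?case using Y by (simp add: lift T.l_distr M.l_distr)
    qed
  next
    fix X r assume "X \<in> carrier tensor"
    then show "tensor_lift M \<phi> (r \<odot>\<^bsub>tensor\<^esub> X) = r \<odot>\<^bsub>M\<^esub> tensor_lift M \<phi> X"
      by (induction X rule: tensor_induct)
        (simp_all add: lift smult pure_smult_left[symmetric] T.smult_add_right M.smult_add_right)
  qed (simp_all add: lift pure_one one)
qed

end

section \<open>Maps between tensor products\<close>

lemma tensor_map_hom:
  assumes A: "cx_algebra A" and B: "cx_algebra B" and A': "cx_algebra A'" and B': "cx_algebra B'"
    and f: "f \<in> algebra_hom A A'" and g: "g \<in> algebra_hom B B'"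
  shows "tensor_map A' B' f g \<in> algebra_hom (tensor_algebra A B) (tensor_algebra A' B')"
    and "\<lbrakk>x \<in> carrier A; y \<in> carrier B\<rbrakk> \<Longrightarrow>
      tensor_map A' B' f g (pure_tensor A B x y) = pure_tensor A' B' (f x) (g y)"
proof -
  interpret S: tensor_pair A B
    using A B by (simp add: tensor_pair_def)
  interpret T: tensor_pair A' B'
    using A' B' by (simp add: tensor_pair_def)
  note f = algebra_homD[OF f] and g = algebra_homD[OF g]
  have bal: "balanced A B T.tensor (\<lambda>x y. T.pure (f x) (g y))"
    unfolding balanced_def
    by (auto simp: f g T.pure_add_left T.pure_add_right T.pure_smult_left T.pure_smult_right)
  show "tensor_map A' B' f g \<in> algebra_hom S.tensor T.tensor"
    unfolding tensor_map_def
    by (rule S.tensor_lift_hom[OF T.tensor_cx_algebra bal])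
      (simp_all add: f g T.pure_smult_left T.pure_mult T.pure_one)
  show "tensor_map A' B' f g (S.pure x y) = T.pure (f x) (g y)"
    if "x \<in> carrier A" "y \<in> carrier B"
    unfolding tensor_map_def
    using that by (rule S.tensor_lift_pure_add(1)[OF T.T.is_abelian_group bal])
qed

text \<open>
  For fixed \<open>z\<close>, the inner lift \<open>\<psi> X z\<close> is additive in \<open>X\<close> by construction. Its behaviour in \<open>z\<close>, under
  scalars and under products is checked on pure tensors \<open>X\<close> and spreads to all \<open>X\<close> by additivity;
  together these properties allow lifting a second time.
\<close>

lemma tensor_assoc_hom:
  assumes A: "cx_algebra A" and B: "cx_algebra B" and C: "cx_algebra C"
  shows "tensor_assoc A B C \<in>
      algebra_hom (tensor_algebra (tensor_algebra A B) C) (tensor_algebra A (tensor_algebra B C))"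
    and "\<lbrakk>x \<in> carrier A; y \<in> carrier B; z \<in> carrier C\<rbrakk> \<Longrightarrow>
      tensor_assoc A B C (pure_tensor (tensor_algebra A B) C (pure_tensor A B x y) z) =
      pure_tensor A (tensor_algebra B C) x (pure_tensor B C y z)"
proof -
  interpret C: cx_algebra C by (rule C)
  interpret AB: tensor_pair A B
    using A B by (simp add: tensor_pair_def)
  interpret BC: tensor_pair B C
    using B C by (simp add: tensor_pair_def)
  interpret L: tensor_pair AB.tensor C
    using AB.tensor_cx_algebra C by (simp add: tensor_pair_def)
  interpret R: tensor_pair A BC.tensor
    using A BC.tensor_cx_algebra by (simp add: tensor_pair_def)
  define \<psi> where "\<psi> X z = tensor_lift R.tensor (\<lambda>x y. R.pure x (BC.pure y z)) X" for X z
  have bal: "balanced A B R.tensor (\<lambda>x y. R.pure x (BC.pure y z))" if "z \<in> carrier C" for z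
    unfolding balanced_def using that
    by (auto simp: R.pure_add_left R.pure_add_right R.pure_smult_left R.pure_smult_right
        BC.pure_add_left BC.pure_smult_left)
  note lift = AB.tensor_lift_pure_add[OF R.T.is_abelian_group bal, folded \<psi>_def]
  have smult: "\<psi> (r \<odot>\<^bsub>AB.tensor\<^esub> X) z = r \<odot>\<^bsub>R.tensor\<^esub> \<psi> X z"
    "\<psi> X (r \<odot>\<^bsub>C\<^esub> z) = r \<odot>\<^bsub>R.tensor\<^esub> \<psi> X z"
    if X: "X \<in> carrier AB.tensor" and z: "z \<in> carrier C" for r X z
    using X
  proof (induction X rule: AB.tensor_induct)
    case (pure x y)
    case 1
    show ?case
      using pure z by (simp add: lift AB.pure_smult_left[symmetric] R.pure_smult_left)
    case 2
    show ?case
      using pure z by (simp add: lift BC.pure_smult_right R.pure_smult_right)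
  next
    case (add X Y)
    case 1
    show ?case
      using add z by (simp add: lift AB.T.smult_add_right R.T.smult_add_right)
    case 2
    show ?case
      using add z by (simp add: lift R.T.smult_add_right)
  qed
  have add_right: "\<psi> X (z \<oplus>\<^bsub>C\<^esub> z') = \<psi> X z \<oplus>\<^bsub>R.tensor\<^esub> \<psi> X z'"
    if X: "X \<in> carrier AB.tensor" and z: "z \<in> carrier C" "z' \<in> carrier C" for X z z'
    using X
  proof (induction X rule: AB.tensor_induct)
    case (pure x y)
    then show ?case
      using z by (simp add: lift BC.pure_add_right R.pure_add_right)
  next
    case (add X Y)
    then show ?case
      using z by (simp add: lift R.T.a_ac)
  qed
  have mult: "\<psi> (X \<otimes>\<^bsub>AB.tensor\<^esub> X') (z \<otimes>\<^bsub>C\<^esub> z') = \<psi> X z \<otimes>\<^bsub>R.tensor\<^esub> \<psi> X' z'"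
    if X: "X \<in> carrier AB.tensor" and X': "X' \<in> carrier AB.tensor"
      and z: "z \<in> carrier C" "z' \<in> carrier C" for X X' z z'
    using X
  proof (induction X rule: AB.tensor_induct)
    case x: (pure x y)
    from X' show ?case
    proof (induction X' rule: AB.tensor_induct)
      case (pure x' y')
      then show ?case
        using x z by (simp add: lift AB.pure_mult BC.pure_mult R.pure_mult)
    next
      case (add X Y)
      then show ?case
        using x z by (simp add: lift AB.T.r_distr R.T.r_distr)
    qed
  next
    case (add X Y)
    then show ?case
      using X' z by (simp add: lift AB.T.l_distr R.T.l_distr)
  qed
  have bal\<psi>: "balanced AB.tensor C R.tensor \<psi>"
    unfolding balanced_def by (simp add: lift add_right smult)
  have assoc: "tensor_assoc A B C = tensor_lift R.tensor \<psi>"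
    by (simp add: tensor_assoc_def Let_def \<psi>_def[abs_def])
  show "tensor_assoc A B C \<in> algebra_hom L.tensor R.tensor"
    unfolding assoc
    by (rule L.tensor_lift_hom[OF R.tensor_cx_algebra bal\<psi>])
      (simp_all add: smult mult AB.pure_one lift, simp add: BC.pure_one R.pure_one)
  show "tensor_assoc A B C (L.pure (AB.pure x y) z) = R.pure x (BC.pure y z)"
    if "x \<in> carrier A" "y \<in> carrier B" "z \<in> carrier C"
    unfolding assoc
    using that by (simp add: L.tensor_lift_pure_add(1)[OF R.T.is_abelian_group bal\<psi>] lift)
qed

section \<open>Conjugate opposite algebras and anti-involutions\<close>

text \<open>
  Homomorphisms into this algebra are the antilinear antimultiplicative maps into \<open>A\<close>.
\<close>

definition conj_op :: "(complex, 'a) module \<Rightarrow> (complex, 'a) module" where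
  "conj_op A =
     \<lparr>carrier = carrier A, monoid.mult = (\<lambda>x y. y \<otimes>\<^bsub>A\<^esub> x), one = \<one>\<^bsub>A\<^esub>, ring.zero = \<zero>\<^bsub>A\<^esub>,
      add = (\<oplus>\<^bsub>A\<^esub>), smult = (\<lambda>r x. cnj r \<odot>\<^bsub>A\<^esub> x)\<rparr>"

lemma conj_op_simps [simp]:
  "carrier (conj_op A) = carrier A" "x \<otimes>\<^bsub>conj_op A\<^esub> y = y \<otimes>\<^bsub>A\<^esub> x" "\<one>\<^bsub>conj_op A\<^esub> = \<one>\<^bsub>A\<^esub>"
  "\<zero>\<^bsub>conj_op A\<^esub> = \<zero>\<^bsub>A\<^esub>" "x \<oplus>\<^bsub>conj_op A\<^esub> y = x \<oplus>\<^bsub>A\<^esub> y" "r \<odot>\<^bsub>conj_op A\<^esub> x = cnj r \<odot>\<^bsub>A\<^esub> x"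
  by (simp_all add: conj_op_def)

lemma conj_op_conj_op: "conj_op (conj_op A) = A"
  by (rule module.equality) (simp_all add: fun_eq_iff)

lemma conj_op_cx_algebra:
  assumes "cx_algebra A"
  shows "cx_algebra (conj_op A)"
proof -
  interpret cx_algebra A by (rule assms)
  have "ring (conj_op A)"
  proof (rule ringI)
    show "abelian_group (conj_op A)"
      by (rule abelian_groupI) (auto simp: a_ac intro: l_neg)
    show "Group.monoid (conj_op A)"
      by (rule monoidI) (simp_all add: m_assoc)
  qed (simp_all add: l_distr r_distr)
  then interpret C: ring "conj_op A" .
  show ?thesis
    by unfold_locales
      (simp_all add: smult_add_left smult_add_right smult_smult smult_mult_left smult_mult_right)
qed

lemma algebra_hom_conj_op: "f \<in> algebra_hom A B \<Longrightarrow> f \<in> algebra_hom (conj_op A) (conj_op B)"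
  by (rule algebra_homI) (simp_all add: algebra_homD)

text \<open>
  An anti-involution \<open>s\<close> fixes the unit, since \<open>s 1 = s 1 * s (s 1) = s (s 1 * 1) = 1\<close>.
\<close>

lemma anti_involution_imp_hom:
  assumes A: "cx_algebra A" and s: "anti_involution A s"
  shows "s \<in> algebra_hom A (conj_op A)"
proof -
  interpret cx_algebra A by (rule A)
  have closed: "s x \<in> carrier A" if "x \<in> carrier A" for x
    using s that by (auto simp: anti_involution_def)
  have mult: "s (x \<otimes>\<^bsub>A\<^esub> y) = s y \<otimes>\<^bsub>A\<^esub> s x" if "x \<in> carrier A" "y \<in> carrier A" for x y
    using s that by (simp add: anti_involution_def)
  have invol: "s (s x) = x" if "x \<in> carrier A" for x
    using s that by (simp add: anti_involution_def)
  have "s \<one>\<^bsub>A\<^esub> = \<one>\<^bsub>A\<^esub>"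
    using mult[of "s \<one>\<^bsub>A\<^esub>" "\<one>\<^bsub>A\<^esub>"] invol[of "\<one>\<^bsub>A\<^esub>"] closed[of "\<one>\<^bsub>A\<^esub>"] by simp
  then show ?thesis
    using s by (intro algebra_homI) (auto simp: anti_involution_def)
qed

lemma anti_involution_if_hom:
  assumes "s \<in> algebra_hom A (conj_op A)" "\<And>x. x \<in> carrier A \<Longrightarrow> s (s x) = x"
  shows "anti_involution A s"
  using assms(2) algebra_homD[OF assms(1)] unfolding anti_involution_def by auto

text \<open>
  Conjugation only permutes the relations \<open>(r x, y) = (x, r y)\<close>, since \<open>r\<close> runs through all complex
  numbers.
\<close>

lemma tensor_null_conj_op [simp]: "tensor_null (conj_op A) (conj_op B) = tensor_null A B"
proof -
  have "{frag_of (cnj r \<odot>\<^bsub>A\<^esub> x, y) - frag_of (x, cnj r \<odot>\<^bsub>B\<^esub> y) |r x y.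
        x \<in> carrier A \<and> y \<in> carrier B} =
      {frag_of (r \<odot>\<^bsub>A\<^esub> x, y) - frag_of (x, r \<odot>\<^bsub>B\<^esub> y) |r x y.
        x \<in> carrier A \<and> y \<in> carrier B}" (is "?L = ?R")
  proof
    show "?L \<subseteq> ?R" by blast
    show "?R \<subseteq> ?L" by (clarsimp, metis complex_cnj_cnj)
  qed
  then have "tensor_rels (conj_op A) (conj_op B) = tensor_rels A B"
    by (simp add: tensor_rels_def)
  then show ?thesis
    by (simp add: tensor_null_def)
qed

lemma tensor_class_conj_op [simp]: "tensor_class (conj_op A) (conj_op B) = tensor_class A B"
  by (simp add: tensor_class_def fun_eq_iff)

lemma pure_tensor_conj_op [simp]: "pure_tensor (conj_op A) (conj_op B) = pure_tensor A B"
  by (simp add: pure_tensor_def fun_eq_iff)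

lemma pair_mult_conj_op: "pair_mult (conj_op A) (conj_op B) u v = pair_mult A B v u"
  using subset_UNIV[of "Poly_Mapping.keys u"]
proof (induction u rule: frag_induction)
  case (one k)
  show ?case
    using subset_UNIV[of "Poly_Mapping.keys v"]
  proof (induction v rule: frag_induction)
    case (one l)
    show ?case by (cases k; cases l) simp
  qed (simp_all add: pair_mult_diff_left pair_mult_diff_right)
qed (simp_all add: pair_mult_diff_left pair_mult_diff_right)

lemma tensor_algebra_conj_op: "tensor_algebra (conj_op A) (conj_op B) = conj_op (tensor_algebra A B)"
proof -
  have "pair_scale (conj_op A) r = (pair_scale A (cnj r) :: ('a \<times> 'b \<Rightarrow>\<^sub>0 int) \<Rightarrow> _)" for r
    by (simp add: pair_scale_def fun_eq_iff)
  then show ?thesis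
    unfolding conj_op_def[of "tensor_algebra A B"]
    by (auto simp: pair_mult_conj_op tensor_algebra_def fun_eq_iff)
qed

text \<open>The lift refers to its target only through the additive group.\<close>

lemma tensor_lift_conj_op: "tensor_lift (conj_op M) = tensor_lift M"
  by (simp add: tensor_lift_def fun_eq_iff finsum_def add_pow_def conj_op_def)

lemma tensor_map_conj_op: "tensor_map (conj_op A) (conj_op B) = tensor_map A B"
  by (simp add: tensor_map_def fun_eq_iff tensor_algebra_conj_op tensor_lift_conj_op)

section \<open>The quantum group algebra\<close>

locale quantum_gl =
  fixes q :: complex
  assumes q_nonzero [simp]: "q \<noteq> 0"
begin

abbreviation a where "a \<equiv> presented_gen (gl_rels q) Ga"
abbreviation b where "b \<equiv> presented_gen (gl_rels q) Gb"
abbreviation c where "c \<equiv> presented_gen (gl_rels q) Gc"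
abbreviation d where "d \<equiv> presented_gen (gl_rels q) Gd"
abbreviation \<theta> where "\<theta> \<equiv> presented_gen (gl_rels q) Gtheta"

lemma GL_cx_algebra: "cx_algebra (GL q)"
  unfolding GL_def by (rule presented_cx_algebra)

lemma gen_closed [simp]: "presented_gen (gl_rels q) g \<in> carrier (GL q)"
  by (simp add: GL_def)

sublocale GL: cx_algebra "GL q"
  by (rule GL_cx_algebra)

sublocale GL2: tensor_pair "GL q" "GL q"
  rewrites "tensor_algebra (GL q) (GL q) = GL2 q"
  by (simp_all add: tensor_pair_def GL_cx_algebra GL2_def)

text \<open>
  The relations in the form of rewrite rules that sort the generators in the order
  \<open>d\<close>, \<open>c\<close>, \<open>\<theta>\<close>, \<open>b\<close>, \<open>a\<close>. Every relation is oriented consistently with this order, so rewriting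
  terminates and brings products of two generators to a normal form.
\<close>

lemma GL_relations:
  "b \<otimes>\<^bsub>GL q\<^esub> c = c \<otimes>\<^bsub>GL q\<^esub> b"
  "a \<otimes>\<^bsub>GL q\<^esub> d = d \<otimes>\<^bsub>GL q\<^esub> a \<oplus>\<^bsub>GL q\<^esub> (q - inverse q) \<odot>\<^bsub>GL q\<^esub> (c \<otimes>\<^bsub>GL q\<^esub> b)"
  "a \<otimes>\<^bsub>GL q\<^esub> b = q \<odot>\<^bsub>GL q\<^esub> (b \<otimes>\<^bsub>GL q\<^esub> a)"
  "a \<otimes>\<^bsub>GL q\<^esub> c = q \<odot>\<^bsub>GL q\<^esub> (c \<otimes>\<^bsub>GL q\<^esub> a)"
  "b \<otimes>\<^bsub>GL q\<^esub> d = q \<odot>\<^bsub>GL q\<^esub> (d \<otimes>\<^bsub>GL q\<^esub> b)"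
  "c \<otimes>\<^bsub>GL q\<^esub> d = q \<odot>\<^bsub>GL q\<^esub> (d \<otimes>\<^bsub>GL q\<^esub> c)"
  "a \<otimes>\<^bsub>GL q\<^esub> \<theta> = inverse q \<odot>\<^bsub>GL q\<^esub> (\<theta> \<otimes>\<^bsub>GL q\<^esub> a)"
  "\<theta> \<otimes>\<^bsub>GL q\<^esub> d = inverse q \<odot>\<^bsub>GL q\<^esub> (d \<otimes>\<^bsub>GL q\<^esub> \<theta>)"
  "b \<otimes>\<^bsub>GL q\<^esub> \<theta> = \<theta> \<otimes>\<^bsub>GL q\<^esub> b"
  "\<theta> \<otimes>\<^bsub>GL q\<^esub> c = c \<otimes>\<^bsub>GL q\<^esub> \<theta>"
proof -
  let ?\<pi> = "\<lambda>p. (Idl\<^bsub>free_algebra\<^esub> (gl_rels q)) +>\<^bsub>free_algebra\<^esub> p"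
  note hom = algebra_homD[OF presented_proj_hom[of "gl_rels q"], simplified, folded GL_def]
  have gen: "?\<pi> (var g) = presented_gen (gl_rels q) g" for g
    by (simp add: presented_gen_def)
  have rel: "?\<pi> p = ?\<pi> p'" if "p - p' \<in> gl_rels q" for p p'
    using that by (rule presented_rel_eq)
  have bc: "?\<pi> (var Gb * var Gc) = ?\<pi> (var Gc * var Gb)"
    by (rule rel) (simp add: gl_rels_def Let_def)
  then show "b \<otimes>\<^bsub>GL q\<^esub> c = c \<otimes>\<^bsub>GL q\<^esub> b"
    by (simp add: hom gen)
  have "?\<pi> (var Ga * var Gd) = ?\<pi> (var Gd * var Ga + scale (q - inverse q) (var Gb * var Gc))"
    by (rule rel) (simp add: gl_rels_def Let_def diff_diff_eq)
  with bc show "a \<otimes>\<^bsub>GL q\<^esub> d = d \<otimes>\<^bsub>GL q\<^esub> a \<oplus>\<^bsub>GL q\<^esub> (q - inverse q) \<odot>\<^bsub>GL q\<^esub> (c \<otimes>\<^bsub>GL q\<^esub> b)"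
    by (simp add: hom gen)
  have "?\<pi> (var Ga * var Gb) = ?\<pi> (scale q (var Gb * var Ga))"
    "?\<pi> (var Ga * var Gc) = ?\<pi> (scale q (var Gc * var Ga))"
    "?\<pi> (var Gb * var Gd) = ?\<pi> (scale q (var Gd * var Gb))"
    "?\<pi> (var Gc * var Gd) = ?\<pi> (scale q (var Gd * var Gc))"
    "?\<pi> (var Ga * var Gtheta) = ?\<pi> (scale (inverse q) (var Gtheta * var Ga))"
    "?\<pi> (var Gtheta * var Gd) = ?\<pi> (scale (inverse q) (var Gd * var Gtheta))"
    "?\<pi> (var Gb * var Gtheta) = ?\<pi> (var Gtheta * var Gb)"
    "?\<pi> (var Gtheta * var Gc) = ?\<pi> (var Gc * var Gtheta)"
    by (rule rel, simp add: gl_rels_def Let_def)+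
  then show "a \<otimes>\<^bsub>GL q\<^esub> b = q \<odot>\<^bsub>GL q\<^esub> (b \<otimes>\<^bsub>GL q\<^esub> a)"
    "a \<otimes>\<^bsub>GL q\<^esub> c = q \<odot>\<^bsub>GL q\<^esub> (c \<otimes>\<^bsub>GL q\<^esub> a)"
    "b \<otimes>\<^bsub>GL q\<^esub> d = q \<odot>\<^bsub>GL q\<^esub> (d \<otimes>\<^bsub>GL q\<^esub> b)"
    "c \<otimes>\<^bsub>GL q\<^esub> d = q \<odot>\<^bsub>GL q\<^esub> (d \<otimes>\<^bsub>GL q\<^esub> c)"
    "a \<otimes>\<^bsub>GL q\<^esub> \<theta> = inverse q \<odot>\<^bsub>GL q\<^esub> (\<theta> \<otimes>\<^bsub>GL q\<^esub> a)"
    "\<theta> \<otimes>\<^bsub>GL q\<^esub> d = inverse q \<odot>\<^bsub>GL q\<^esub> (d \<otimes>\<^bsub>GL q\<^esub> \<theta>)"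
    "b \<otimes>\<^bsub>GL q\<^esub> \<theta> = \<theta> \<otimes>\<^bsub>GL q\<^esub> b"
    "\<theta> \<otimes>\<^bsub>GL q\<^esub> c = c \<otimes>\<^bsub>GL q\<^esub> \<theta>"
    by (simp_all add: hom gen)
qed

lemma GL_hom_exists:
  assumes B: "cx_algebra B" and h: "\<And>g. h g \<in> carrier B"
    and ad: "h Ga \<otimes>\<^bsub>B\<^esub> h Gd = h Gd \<otimes>\<^bsub>B\<^esub> h Ga \<oplus>\<^bsub>B\<^esub> (q - inverse q) \<odot>\<^bsub>B\<^esub> (h Gb \<otimes>\<^bsub>B\<^esub> h Gc)"
    and bc: "h Gb \<otimes>\<^bsub>B\<^esub> h Gc = h Gc \<otimes>\<^bsub>B\<^esub> h Gb"
    and ab: "h Ga \<otimes>\<^bsub>B\<^esub> h Gb = q \<odot>\<^bsub>B\<^esub> (h Gb \<otimes>\<^bsub>B\<^esub> h Ga)"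
    and ac: "h Ga \<otimes>\<^bsub>B\<^esub> h Gc = q \<odot>\<^bsub>B\<^esub> (h Gc \<otimes>\<^bsub>B\<^esub> h Ga)"
    and bd: "h Gb \<otimes>\<^bsub>B\<^esub> h Gd = q \<odot>\<^bsub>B\<^esub> (h Gd \<otimes>\<^bsub>B\<^esub> h Gb)"
    and cd: "h Gc \<otimes>\<^bsub>B\<^esub> h Gd = q \<odot>\<^bsub>B\<^esub> (h Gd \<otimes>\<^bsub>B\<^esub> h Gc)"
    and at: "h Ga \<otimes>\<^bsub>B\<^esub> h Gtheta = inverse q \<odot>\<^bsub>B\<^esub> (h Gtheta \<otimes>\<^bsub>B\<^esub> h Ga)"
    and td: "h Gtheta \<otimes>\<^bsub>B\<^esub> h Gd = inverse q \<odot>\<^bsub>B\<^esub> (h Gd \<otimes>\<^bsub>B\<^esub> h Gtheta)"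
    and bt: "h Gb \<otimes>\<^bsub>B\<^esub> h Gtheta = h Gtheta \<otimes>\<^bsub>B\<^esub> h Gb"
    and tc: "h Gtheta \<otimes>\<^bsub>B\<^esub> h Gc = h Gc \<otimes>\<^bsub>B\<^esub> h Gtheta"
  shows "\<exists>f\<in>algebra_hom (GL q) B. f \<in> extensional (carrier (GL q)) \<and>
    (\<forall>g. f (presented_gen (gl_rels q) g) = h g)"
proof -
  interpret B: cx_algebra B by (rule B)
  note e = B.free_eval_add[of h, OF h] B.free_eval_mult[of h, OF h] B.free_eval_scale[of h, OF h]
    B.free_eval_var[of h, OF h]
  have "free_eval B h p = \<zero>\<^bsub>B\<^esub>" if "p \<in> gl_rels q" for p
  proof -
    have "free_eval B h (u - v) = \<zero>\<^bsub>B\<^esub>" if "free_eval B h u = free_eval B h v" for u v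
      using that B.free_eval_diff_eq_zero_iff[of h, OF h] by blast
    note diff_zero = this
    from that show ?thesis
      unfolding gl_rels_def Let_def diff_diff_eq insert_iff empty_iff
      by (elim disjE; clarify?; (intro diff_zero)?) (simp_all add: e ad bc ab ac bd cd at td bt tc)
  qed
  from presented_algebra_lift[OF B h this] obtain f
    where f: "f \<in> algebra_hom (GL q) B" "\<And>g. f (presented_gen (gl_rels q) g) = h g"
    unfolding GL_def by blast
  then show ?thesis
    by (intro bexI[of _ "restrict f (carrier (GL q))"] algebra_hom_restrict)
      (auto simp: GL.ring_axioms)
qed

lemma GL_hom_eqI:
  assumes "f \<in> algebra_hom (GL q) B" "f' \<in> algebra_hom (GL q) B"
    and "f a = f' a" "f b = f' b" "f c = f' c" "f d = f' d" "f \<theta> = f' \<theta>"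
    and "x \<in> carrier (GL q)"
  shows "f x = f' x"
proof (rule presented_algebra_hom_eqI)
  show "f (presented_gen (gl_rels q) g) = f' (presented_gen (gl_rels q) g)" for g
    using assms by (cases g) simp_all
qed (use assms in \<open>simp_all add: GL_def\<close>)

abbreviation t where "t \<equiv> pure_tensor (GL q) (GL q)"

text \<open>
  After multiplying out, both components of every pure tensor are products of two generators; sorting
  them and collecting the powers of \<open>q\<close> makes the two sides of each relation equal.
\<close>

lemma coproduct_exists: "\<exists>\<delta>. gl_coproduct q \<delta>"
proof -
  define h where "h g = (case g of Ga \<Rightarrow> t a \<theta> \<oplus>\<^bsub>GL2 q\<^esub> t b a | Gb \<Rightarrow> t b b | Gc \<Rightarrow> t c c
    | Gd \<Rightarrow> t c d | Gtheta \<Rightarrow> t \<theta> \<theta>)" for g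
  note calc = GL2.pure_mult GL_relations GL2.T.l_distr GL2.T.r_distr GL2.pure_smult_left
    GL2.pure_smult_right GL2.T.smult_smult GL2.T.smult_add_right GL2.pure_add_left
    GL2.pure_add_right GL2.T.a_ac
  have "\<exists>f\<in>algebra_hom (GL q) (GL2 q). f \<in> extensional (carrier (GL q)) \<and>
      (\<forall>g. f (presented_gen (gl_rels q) g) = h g)"
  proof (rule GL_hom_exists)
    show "cx_algebra (GL2 q)"
      by (rule GL2.tensor_cx_algebra)
    show "h g \<in> carrier (GL2 q)" for g
      by (cases g) (simp_all add: h_def)
  qed (simp_all add: h_def calc)
  then show ?thesis
    by (auto simp: gl_coproduct_def h_def Let_def)
qed

lemma coproduct_unique:
  assumes "gl_coproduct q \<delta>" "gl_coproduct q \<delta>'"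
  shows "\<delta> = \<delta>'"
proof (rule extensionalityI[of _ "carrier (GL q)"])
  fix x assume "x \<in> carrier (GL q)"
  with assms show "\<delta> x = \<delta>' x"
    by - (rule GL_hom_eqI[of \<delta> "GL2 q" \<delta>'], simp_all add: gl_coproduct_def Let_def)
qed (use assms in \<open>simp_all add: gl_coproduct_def Let_def\<close>)

lemma coproduct_coassociative:
  assumes \<delta>: "gl_coproduct q \<delta>" and x: "x \<in> carrier (GL q)"
  shows "tensor_map (GL q) (GL2 q) (\<lambda>y. y) \<delta> (\<delta> x) =
    tensor_assoc (GL q) (GL q) (GL q) (tensor_map (GL2 q) (GL q) \<delta> (\<lambda>y. y) (\<delta> x))"
proof -
  interpret L: tensor_pair "GL2 q" "GL q"
    by (simp add: tensor_pair_def GL_cx_algebra GL2.tensor_cx_algebra)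
  interpret R: tensor_pair "GL q" "GL2 q"
    by (simp add: tensor_pair_def GL_cx_algebra GL2.tensor_cx_algebra)
  note algs = GL_cx_algebra GL2.tensor_cx_algebra
  have \<delta>_hom: "\<delta> \<in> algebra_hom (GL q) (GL2 q)"
    and gens: "\<delta> a = t a \<theta> \<oplus>\<^bsub>GL2 q\<^esub> t b a" "\<delta> \<theta> = t \<theta> \<theta>" "\<delta> c = t c c" "\<delta> b = t b b" "\<delta> d = t c d"
    using \<delta> by (simp_all add: gl_coproduct_def Let_def)
  note right = tensor_map_hom[OF algs(1) algs(1) algs(1) algs(2) algebra_hom_ident \<delta>_hom,
      folded GL2_def]
  note left = tensor_map_hom[OF algs(1) algs(1) algs(2) algs(1) \<delta>_hom algebra_hom_ident,
      folded GL2_def]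
  note assoc = tensor_assoc_hom[OF algs(1) algs(1) algs(1), folded GL2_def]
  note calc = gens right(2) left(2) assoc(2) algebra_homD(2)[OF right(1)]
    algebra_homD(2)[OF left(1)] algebra_homD(2)[OF assoc(1)] L.pure_add_left R.pure_add_right
    R.T.a_ac
  show ?thesis
    by (rule GL_hom_eqI[where x = x, OF algebra_hom_compose[OF \<delta>_hom right(1)]
          algebra_hom_compose[OF algebra_hom_compose[OF \<delta>_hom left(1)] assoc(1)]])
      (use x in \<open>simp_all add: calc\<close>)
qed

text \<open>
  The relations hold for the generators in the conjugate opposite algebra, where products are
  reversed and \<open>q\<close> acts as \<open>inverse q\<close>. The resulting map is an involution because its square is an
  ordinary endomorphism of the algebra that fixes the generators.
\<close>

lemma star_exists:
  assumes q_unit: "cnj q = inverse q"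
  shows "\<exists>s. gl_star q s"
proof -
  note calc = GL_relations GL.smult_smult q_unit GL.a_assoc GL.smult_add_left[symmetric]
  have "\<exists>f\<in>algebra_hom (GL q) (conj_op (GL q)). f \<in> extensional (carrier (GL q)) \<and>
      (\<forall>g. f (presented_gen (gl_rels q) g) = presented_gen (gl_rels q) g)"
    by (rule GL_hom_exists) (simp_all add: conj_op_cx_algebra GL_cx_algebra calc)
  then obtain s where s: "s \<in> algebra_hom (GL q) (conj_op (GL q))" "s \<in> extensional (carrier (GL q))"
    and gen: "\<And>g. s (presented_gen (gl_rels q) g) = presented_gen (gl_rels q) g"
    by blast
  have ss: "(\<lambda>x. s (s x)) \<in> algebra_hom (GL q) (GL q)"
    using algebra_hom_compose[OF s(1) algebra_hom_conj_op[OF s(1)]] by (simp add: conj_op_conj_op)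
  have "s (s x) = x" if "x \<in> carrier (GL q)" for x
    using that by - (rule GL_hom_eqI[where x = x, OF ss algebra_hom_ident], simp_all add: gen)
  then show ?thesis
    using s gen anti_involution_if_hom[OF s(1)] by (auto simp: gl_star_def)
qed

lemma star_hom: "gl_star q s \<Longrightarrow> s \<in> algebra_hom (GL q) (conj_op (GL q))"
  using anti_involution_imp_hom[OF GL_cx_algebra] by (simp add: gl_star_def)

lemma star_unique:
  assumes "gl_star q s" "gl_star q s'"
  shows "s = s'"
proof (rule extensionalityI[of _ "carrier (GL q)"])
  fix x assume "x \<in> carrier (GL q)"
  with assms show "s x = s' x"
    by - (rule GL_hom_eqI[OF star_hom[OF assms(1)] star_hom[OF assms(2)]], simp_all add: gl_star_def)
qed (use assms in \<open>simp_all add: gl_star_def\<close>)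

text \<open>
  Both sides are homomorphisms from \<open>GL\<close> to the conjugate opposite of \<open>GL \<otimes> GL\<close>; on the right this
  uses that a homomorphism \<open>\<delta>\<close> is also one between the conjugate opposites.
\<close>

lemma coproduct_star:
  assumes \<delta>: "gl_coproduct q \<delta>" and s: "gl_star q s" and x: "x \<in> carrier (GL q)"
  shows "tensor_map (GL q) (GL q) s s (\<delta> x) = \<delta> (s x)"
proof -
  have \<delta>_hom: "\<delta> \<in> algebra_hom (GL q) (GL2 q)"
    and gens: "\<delta> a = t a \<theta> \<oplus>\<^bsub>GL2 q\<^esub> t b a" "\<delta> \<theta> = t \<theta> \<theta>" "\<delta> c = t c c" "\<delta> b = t b b" "\<delta> d = t c d"
    using \<delta> by (simp_all add: gl_coproduct_def Let_def)
  have star: "s (presented_gen (gl_rels q) g) = presented_gen (gl_rels q) g" for g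
    using s by (simp add: gl_star_def)
  note co = conj_op_cx_algebra[OF GL_cx_algebra]
  note ss = tensor_map_hom[OF GL_cx_algebra GL_cx_algebra co co star_hom[OF s] star_hom[OF s],
      unfolded tensor_map_conj_op tensor_algebra_conj_op pure_tensor_conj_op, folded GL2_def]
  show ?thesis
    by (rule GL_hom_eqI[where x = x, OF algebra_hom_compose[OF \<delta>_hom ss(1)]
          algebra_hom_compose[OF star_hom[OF s] algebra_hom_conj_op[OF \<delta>_hom]]])
      (use x in \<open>simp_all add: gens star ss(2) algebra_homD(2)[OF ss(1), simplified]\<close>)
qed

end

theorem proposition4:
  fixes \<gamma> :: real and q :: complex
  assumes "0 < \<gamma>" and "\<gamma> < pi" and "q = exp (\<i> * complex_of_real \<gamma>)"
  shows "(\<exists>!\<delta>. gl_coproduct q \<delta>) \<and>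
    (\<exists>!s. gl_star q s) \<and>
    (\<forall>\<delta>. gl_coproduct q \<delta> \<longrightarrow>
      (\<forall>x\<in>carrier (GL q).
        tensor_map (GL q) (GL2 q) (\<lambda>y. y) \<delta> (\<delta> x) =
        tensor_assoc (GL q) (GL q) (GL q) (tensor_map (GL2 q) (GL q) \<delta> (\<lambda>y. y) (\<delta> x)))) \<and>
    (\<forall>\<delta> s. gl_coproduct q \<delta> \<longrightarrow> gl_star q s \<longrightarrow>
      (\<forall>x\<in>carrier (GL q). tensor_map (GL q) (GL q) s s (\<delta> x) = \<delta> (s x)))"
proof -
  interpret quantum_gl q
    by unfold_locales (simp add: assms(3))
  have unit: "cnj q = inverse q"
    by (simp add: assms(3) cis_conv_exp[symmetric] cis_cnj)
  show ?thesis
    using coproduct_exists coproduct_unique star_exists[OF unit] star_unique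
      coproduct_coassociative coproduct_star
    by blast
qed

end
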